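(* Let $p>0$ and let $\{(M^n_t)_{0\le t\le T}:n\ge0\}$ be a sequence of real-valued continuous local martingales vanishing at zero. Then $$\sum_{n\ge0}\langle M^n\rangle_T^{p/2}\ \text{converges a.s.}\quad\Longleftrightarrow\quad\sum_{n\ge0}\sup_{0\le t\le T}|M^n_t|^p\ \text{converges a.s.}$$
   Context: $T>0$ is fixed; the filtered probability space $(\Omega,\mathcal F,(\mathcal F_t)_{0\le t\le T},\mathbb P)$ is such that $(\mathcal F_t)$ is the $\mathbb P$-augmented natural filtration of a $d$-dimensional Brownian motion and $\mathcal F=\mathcal F_T$. $\langle M\rangle$ denotes the quadratic variation of $M$. *)

theory Defs
  imports "HOL-Probability.Probability"
begin

text \<open>
  The time interval is \<open>{0..T}\<close>. A process is a function \<open>real \<Rightarrow> 'a \<Rightarrow> 'b\<close> whose values at times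
  outside \<open>{0..T}\<close> are irrelevant. Pathwise properties are required almost surely only.
\<close>

definition brownian_motion ::
    "'a measure \<Rightarrow> real \<Rightarrow> (real \<Rightarrow> 'a \<Rightarrow> real ^ 'd) \<Rightarrow> bool" where
  "brownian_motion P T B \<longleftrightarrow>
     (\<forall>t\<in>{0..T}. B t \<in> borel_measurable P) \<and>
     (AE \<omega> in P. B 0 \<omega> = 0) \<and>
     (AE \<omega> in P. continuous_on {0..T} (\<lambda>t. B t \<omega>)) \<and>
     (\<forall>s t. 0 \<le> s \<longrightarrow> s < t \<longrightarrow> t \<le> T \<longrightarrow>
        distributed P lborel (\<lambda>\<omega>. B t \<omega> - B s \<omega>)
          (\<lambda>x. ennreal (\<Prod>i\<in>UNIV. normal_density 0 (sqrt (t - s)) (x $ i)))) \<and>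
     (\<forall>(n::nat) t. t ` {..n} \<subseteq> {0..T} \<longrightarrow> (\<forall>i<n. t i \<le> t (Suc i)) \<longrightarrow>
        prob_space.indep_vars P (\<lambda>_. borel) (\<lambda>i \<omega>. B (t (Suc i)) \<omega> - B (t i) \<omega>) {..<n})"

text \<open>
  The natural filtration of \<open>B\<close>, augmented by all \<open>P\<close>-negligible sets (subsets of \<open>P\<close>-null sets).
  It is extended to all real times so that the library notions \<open>filtration\<close> and \<open>stopping_time\<close>
  apply: it is constant after \<open>T\<close> and contains only trivial events before \<open>0\<close>.
\<close>

definition augmented_natural_filtration ::
    "'a measure \<Rightarrow> real \<Rightarrow> (real \<Rightarrow> 'a \<Rightarrow> 'b::topological_space) \<Rightarrow> real \<Rightarrow> 'a measure" where
  "augmented_natural_filtration P T B t =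
     sigma (space P)
       ({B s -` A \<inter> space P | s A. s \<in> {0..min t T} \<and> A \<in> sets borel} \<union>
        {N. \<exists>N'\<in>null_sets P. N \<subseteq> N'})"

lemma filtration_augmented_natural_filtration:
  "filtration (space P) (augmented_natural_filtration P T B)"
proof
  have sub: "{B s -` A \<inter> space P | s A. s \<in> {0..min t T} \<and> A \<in> sets borel} \<union>
        {N. \<exists>N'\<in>null_sets P. N \<subseteq> N'} \<subseteq> Pow (space P)" for t
    using sets.sets_into_space[of _ P] by (fastforce simp: null_sets_def)
  show "space (augmented_natural_filtration P T B t) = space P" for t
    unfolding augmented_natural_filtration_def using sub by (rule space_measure_of)
  show "sets (augmented_natural_filtration P T B s) \<subseteq> sets (augmented_natural_filtration P T B t)"
    if "s \<le> t" for s t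
    unfolding augmented_natural_filtration_def sets_measure_of[OF sub]
    by (rule sigma_sets_mono') (use that in fastforce)
qed

definition adapted_process ::
    "(real \<Rightarrow> 'a measure) \<Rightarrow> real \<Rightarrow> (real \<Rightarrow> 'a \<Rightarrow> real) \<Rightarrow> bool" where
  "adapted_process F T X \<longleftrightarrow> (\<forall>t\<in>{0..T}. X t \<in> borel_measurable (F t))"

definition martingale ::
    "'a measure \<Rightarrow> (real \<Rightarrow> 'a measure) \<Rightarrow> real \<Rightarrow> (real \<Rightarrow> 'a \<Rightarrow> real) \<Rightarrow> bool" where
  "martingale P F T X \<longleftrightarrow>
     adapted_process F T X \<and>
     (\<forall>t\<in>{0..T}. integrable P (X t)) \<and>
     (\<forall>s t. 0 \<le> s \<longrightarrow> s \<le> t \<longrightarrow> t \<le> T \<longrightarrow>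
        (AE \<omega> in P. real_cond_exp P (F s) (X t) \<omega> = X s \<omega>))"

text \<open>
  On the closed interval \<open>{0..T}\<close>, a localizing sequence consists of stopping times with values in
  \<open>{0..T}\<close> that almost surely increase and are eventually equal to \<open>T\<close>.
\<close>

definition continuous_local_martingale ::
    "'a measure \<Rightarrow> (real \<Rightarrow> 'a measure) \<Rightarrow> real \<Rightarrow> (real \<Rightarrow> 'a \<Rightarrow> real) \<Rightarrow> bool" where
  "continuous_local_martingale P F T X \<longleftrightarrow>
     adapted_process F T X \<and>
     (AE \<omega> in P. continuous_on {0..T} (\<lambda>t. X t \<omega>)) \<and>
     (\<exists>\<tau> :: nat \<Rightarrow> 'a \<Rightarrow> real.
        (\<forall>k. stopping_time F (\<tau> k) \<and> \<tau> k ` space P \<subseteq> {0..T}) \<and>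
        (AE \<omega> in P. incseq (\<lambda>k. \<tau> k \<omega>) \<and> (\<forall>\<^sub>F k in sequentially. \<tau> k \<omega> = T)) \<and>
        (\<forall>k. martingale P F T (\<lambda>t \<omega>. X (min t (\<tau> k \<omega>)) \<omega>)))"

text \<open>
  \<open>A\<close> is (a version of) the quadratic variation \<open>\<langle>X\<rangle>\<close> of a continuous local martingale \<open>X\<close> with
  \<open>X 0 = 0\<close>: the continuous adapted nondecreasing process, unique up to indistinguishability, that
  starts at \<open>0\<close> and makes \<open>X\<^sup>2 - A\<close> a continuous local martingale.
\<close>

definition is_quadratic_variation ::
    "'a measure \<Rightarrow> (real \<Rightarrow> 'a measure) \<Rightarrow> real \<Rightarrow> (real \<Rightarrow> 'a \<Rightarrow> real) \<Rightarrow> (real \<Rightarrow> 'a \<Rightarrow> real) \<Rightarrow> bool"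
  where
  "is_quadratic_variation P F T X A \<longleftrightarrow>
     adapted_process F T A \<and>
     (AE \<omega> in P. A 0 \<omega> = 0 \<and> continuous_on {0..T} (\<lambda>t. A t \<omega>) \<and> mono_on {0..T} (\<lambda>t. A t \<omega>)) \<and>
     continuous_local_martingale P F T (\<lambda>t \<omega>. (X t \<omega>)\<^sup>2 - A t \<omega>)"

end

theory Submission
  imports Defs
begin

text \<open>
  Both implications come from moment inequalities of Burkholder, Davis and Gundy type, valid for
  every \<open>p > 0\<close> and every stopping time \<open>\<theta>\<close> up to which the processes are bounded: the \<open>p\<close>-th moment
  of \<open>sup\<^sub>t\<^sub>\<le>\<^sub>\<theta> \<bar>M t\<bar>\<close> and the \<open>p/2\<close>-th moment of \<open>\<langle>M\<rangle> \<theta>\<close> dominate each other up to constants that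
  depend on \<open>p\<close> only. Such inequalities pass to series: stopping when \<open>\<Sum>n<N. \<langle>M n\<rangle>\<^bsup>p/2\<^esup>\<close> reaches \<open>K\<close>
  bounds the expectation of the other partial sum by a multiple of \<open>K\<close>, uniformly in \<open>N\<close>, and on the
  event that the first series stays below \<open>K\<close> this stopping never occurs; the converse is symmetric.

  The moment inequalities are good-lambda inequalities. They need nothing but \<open>E M\<^sub>\<rho> = 0\<close> and
  \<open>E M\<^sub>\<rho>\<^sup>2 = E \<langle>M\<rangle>\<^sub>\<rho>\<close>, applied at hitting times. For the supremum of \<open>M\<close> the one-sided level \<open>l\<close> is used
  because \<open>M = l\<close> at the hitting time, so the cross term in \<open>E (M\<^sub>\<rho> - M\<^sub>\<sigma>)\<^sup>2\<close> vanishes without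
  conditional expectations.
\<close>

section \<open>Rounding times up to a grid\<close>

text \<open>Upward rounding decides the rounded time no earlier than the original one, so stopping
  times stay observable. The mesh is \<open>1 / Suc m\<close>, which avoids a zero denominator, and
  the cap at \<open>T\<close> keeps the last cell inside the time interval.\<close>

definition grid_ceil :: "real \<Rightarrow> nat \<Rightarrow> real \<Rightarrow> real" where
  "grid_ceil T m x = min T (real_of_int \<lceil>x * real (Suc m)\<rceil> / real (Suc m))"

lemma grid_ceil_ge:
  assumes "x \<le> T" shows "x \<le> grid_ceil T m x"
proof -
  have "x * real (Suc m) \<le> real_of_int \<lceil>x * real (Suc m)\<rceil>" by (rule le_of_int_ceiling)
  then show ?thesis using assms by (simp add: grid_ceil_def pos_le_divide_eq del: of_nat_Suc)
qed

lemma grid_ceil_mem: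
  assumes "x \<in> {0..T}" shows "grid_ceil T m x \<in> {0..T}"
  using assms grid_ceil_ge[of x T m] by (auto simp: grid_ceil_def)

lemma grid_ceil_tendsto:
  assumes "x \<le> T" shows "(\<lambda>m. grid_ceil T m x) \<longlonglongrightarrow> x"
proof (rule tendsto_sandwich[OF _ _ tendsto_const])
  show "\<forall>\<^sub>F m in sequentially. x \<le> grid_ceil T m x" using grid_ceil_ge[OF assms] by simp
  have "grid_ceil T m x \<le> x + inverse (real (Suc m))" for m
  proof -
    have "real_of_int \<lceil>x * real (Suc m)\<rceil> \<le> x * real (Suc m) + 1" by linarith
    then have "real_of_int \<lceil>x * real (Suc m)\<rceil> / real (Suc m) \<le> x + inverse (real (Suc m))"
      by (simp add: divide_simps del: of_nat_Suc)
    then show ?thesis by (simp add: grid_ceil_def del: of_nat_Suc)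
  qed
  then show "\<forall>\<^sub>F m in sequentially. grid_ceil T m x \<le> x + inverse (real (Suc m))" by simp
  show "(\<lambda>m. x + inverse (real (Suc m))) \<longlonglongrightarrow> x"
    using tendsto_add[OF tendsto_const LIMSEQ_inverse_real_of_nat, of x] by simp
qed

subsection \<open>Optional stopping\<close>

text \<open>The abstract setting for all estimates. \<open>sets_F_T\<close> makes every event of
  \<open>P\<close> observable at the final time, and \<open>null_sets_F\<close> allows an adapted
  process to be altered on a null set without losing adaptedness.\<close>

locale complete_filtered_space = prob_space P + filtration "space P" F
  for P :: "'a measure" and F :: "real \<Rightarrow> 'a measure" +
  fixes T :: real
  assumes sets_F_T: "sets (F T) = sets P" and T_nonneg: "0 \<le> T"
    and null_sets_F: "N \<in> null_sets P \<Longrightarrow> N \<in> sets (F t)"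
begin

lemma sets_F_le: "t \<le> T \<Longrightarrow> sets (F t) \<subseteq> sets P"
  using sets_F_mono[of t T] sets_F_T by simp

lemma subalgebra_F: "t \<le> T \<Longrightarrow> subalgebra P (F t)"
  by (simp add: subalgebra_def space_F sets_F_le)

lemma measurable_F_P: "t \<le> T \<Longrightarrow> f \<in> borel_measurable (F t) \<Longrightarrow> f \<in> borel_measurable P"
  by (rule measurable_from_subalg[OF subalgebra_F])

lemma measurable_F_mono: "s \<le> t \<Longrightarrow> f \<in> borel_measurable (F s) \<Longrightarrow> f \<in> borel_measurable (F t)"
  by (rule measurable_from_subalg) (auto simp: subalgebra_def space_F sets_F_mono)

definition bounded_stopping_time :: "('a \<Rightarrow> real) \<Rightarrow> bool" where
  "bounded_stopping_time \<rho> \<longleftrightarrow> stopping_time F \<rho> \<and> (\<forall>\<omega>\<in>space P. \<rho> \<omega> \<in> {0..T})"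

text \<open>
  Unlike in \<open>continuous_local_martingale\<close>, all paths are continuous; since the filtration contains the
  null sets, an adapted process can be set to \<open>0\<close> where its path is irregular.
\<close>

definition continuous_process :: "(real \<Rightarrow> 'a \<Rightarrow> real) \<Rightarrow> bool" where
  "continuous_process X \<longleftrightarrow> adapted_process F T X \<and> (\<forall>\<omega>\<in>space P. continuous_on {0..T} (\<lambda>t. X t \<omega>))"

lemma bounded_stopping_time_mem: "bounded_stopping_time \<rho> \<Longrightarrow> \<omega> \<in> space P \<Longrightarrow> \<rho> \<omega> \<in> {0..T}"
  by (auto simp: bounded_stopping_time_def)

lemma bounded_stopping_time_min: "bounded_stopping_time \<rho> \<Longrightarrow> bounded_stopping_time \<sigma> \<Longrightarrow> bounded_stopping_time (\<lambda>\<omega>. min (\<rho> \<omega>) (\<sigma> \<omega>))"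
  by (auto simp: bounded_stopping_time_def intro!: stopping_time_min)

lemma bounded_stopping_time_measurable:
  assumes "bounded_stopping_time \<rho>" shows "\<rho> \<in> borel_measurable P"
proof (rule borel_measurableI_le)
  fix t
  show "{\<omega>\<in>space P. \<rho> \<omega> \<le> t} \<in> sets P"
  proof (cases "t \<le> T")
    case True
    have "{\<omega>\<in>space (F t). \<rho> \<omega> \<le> t} \<in> sets (F t)"
      using assms stopping_timeD[of F \<rho> t] by (auto simp: bounded_stopping_time_def pred_def)
    then show ?thesis using sets_F_le[OF True] by (auto simp: space_F)
  next
    \<comment> \<open>Containment of \<open>F t\<close> in \<open>sets P\<close> is available only
      up to \<open>T\<close>; beyond \<open>T\<close> the event is the whole space because
      \<open>\<rho>\<close> takes values in \<open>{0..T}\<close>.\<close>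
    case False
    then have "{\<omega>\<in>space P. \<rho> \<omega> \<le> t} = space P" using bounded_stopping_time_mem[OF assms] by fastforce
    then show ?thesis by simp
  qed
qed

text \<open>The rounded time has countably many values, so evaluating \<open>X\<close> there patches
  together countably many measurable functions. Since \<open>Z\<close> is indexed by all integers,
  its times are clamped to \<open>{0..T}\<close>, where \<open>X\<close> is known to be
  measurable.\<close>

lemma grid_measurable:
  assumes X: "\<And>t. t \<in> {0..T} \<Longrightarrow> X t \<in> borel_measurable P"
    and \<rho>[measurable]: "\<rho> \<in> borel_measurable P" and mem: "\<And>\<omega>. \<omega> \<in> space P \<Longrightarrow> \<rho> \<omega> \<in> {0..T}"
  shows "(\<lambda>\<omega>. X (grid_ceil T m (\<rho> \<omega>)) \<omega>) \<in> borel_measurable P"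
proof -
  define g where "g = (\<lambda>\<omega>. \<lceil>\<rho> \<omega> * real (Suc m)\<rceil>)"
  define Z where "Z = (\<lambda>i::int. X (max 0 (min T (real_of_int i / real (Suc m)))))"
  have "(\<lambda>\<omega>. Z (g \<omega>) \<omega>) \<in> borel_measurable P"
  proof (rule measurable_compose_countable[where f = Z and g = g])
    show "Z i \<in> borel_measurable P" for i unfolding Z_def using T_nonneg by (intro X) auto
    show "g \<in> P \<rightarrow>\<^sub>M count_space UNIV" unfolding g_def by measurable
  qed
  moreover have "Z (g \<omega>) \<omega> = X (grid_ceil T m (\<rho> \<omega>)) \<omega>" if "\<omega> \<in> space P" for \<omega>
  proof -
    have "Z (g \<omega>) = X (max 0 (grid_ceil T m (\<rho> \<omega>)))" by (simp only: Z_def g_def grid_ceil_def)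
    moreover have "max 0 (grid_ceil T m (\<rho> \<omega>)) = grid_ceil T m (\<rho> \<omega>)"
      using grid_ceil_mem[OF mem[OF that], of m] by (intro max.absorb2) simp
    ultimately show ?thesis by (simp only:)
  qed
  ultimately show ?thesis by (rule measurable_cong[THEN iffD1, rotated])
qed

text \<open>Path continuity makes the value at \<open>\<rho>\<close> a pointwise limit of the values
  at the rounded times.\<close>

lemma measurable_at_time:
  assumes "continuous_process X" and \<rho>: "\<rho> \<in> borel_measurable P" and mem: "\<And>\<omega>. \<omega> \<in> space P \<Longrightarrow> \<rho> \<omega> \<in> {0..T}"
  shows "(\<lambda>\<omega>. X (\<rho> \<omega>) \<omega>) \<in> borel_measurable P"
proof (rule borel_measurable_LIMSEQ_real)
  show "(\<lambda>\<omega>. X (grid_ceil T m (\<rho> \<omega>)) \<omega>) \<in> borel_measurable P" for m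
  proof (rule grid_measurable[OF _ \<rho> mem])
    show "X t \<in> borel_measurable P" if "t \<in> {0..T}" for t
      using assms(1) that measurable_F_P[of t "X t"] by (auto simp: continuous_process_def adapted_process_def)
  qed
  show "(\<lambda>m. X (grid_ceil T m (\<rho> \<omega>)) \<omega>) \<longlonglongrightarrow> X (\<rho> \<omega>) \<omega>" if "\<omega> \<in> space P" for \<omega>
    using assms(1) that mem[OF that] grid_ceil_mem[OF mem[OF that]]
    by (intro continuous_on_tendsto_compose[OF _ grid_ceil_tendsto]) (auto simp: continuous_process_def)
qed

text \<open>The factor \<open>f\<close> is known at time \<open>t\<close>, so it can be taken into
  the conditional expectation of \<open>Y T\<close>. This form covers events, bounded functions of
  \<open>Y t\<close> and, with the weight \<open>1\<close>, constancy of the expectation.\<close>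

lemma martingale_weighted:
  assumes mart: "martingale P F T Y" and t: "t \<in> {0..T}"
    and f[measurable]: "f \<in> borel_measurable (F t)" and bnd: "\<And>\<omega>. \<bar>f \<omega>\<bar> \<le> 1"
  shows "integrable P (\<lambda>\<omega>. f \<omega> * Y t \<omega>)" "(\<integral>\<omega>. f \<omega> * Y t \<omega> \<partial>P) = (\<integral>\<omega>. f \<omega> * Y T \<omega> \<partial>P)"
proof -
  interpret S: finite_measure_subalgebra P "F t"
    using subalgebra_F t by unfold_locales auto
  have fP[measurable]: "f \<in> borel_measurable P" using t by (intro measurable_F_P[OF _ f]) auto
  have int: "integrable P (Y s)" if "s \<in> {0..T}" for s using mart that by (auto simp: martingale_def)
  have fi: "integrable P (\<lambda>\<omega>. f \<omega> * Y s \<omega>)" if "s \<in> {0..T}" for s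
  proof (rule Bochner_Integration.integrable_bound[OF int[OF that]])
    show "(\<lambda>\<omega>. f \<omega> * Y s \<omega>) \<in> borel_measurable P" using int[OF that] by measurable
    show "AE \<omega> in P. norm (f \<omega> * Y s \<omega>) \<le> norm (Y s \<omega>)"
      using bnd by (auto simp: abs_mult intro!: mult_left_le_one_le)
  qed
  show "integrable P (\<lambda>\<omega>. f \<omega> * Y t \<omega>)" using fi t by auto
  have T: "T \<in> {0..T}" using T_nonneg by auto
  have [measurable]: "Y t \<in> borel_measurable P" "Y T \<in> borel_measurable P" using int t T by auto
  have ce: "AE \<omega> in P. real_cond_exp P (F t) (Y T) \<omega> = Y t \<omega>"
    using mart t by (auto simp: martingale_def)
  have "(\<integral>\<omega>. f \<omega> * Y T \<omega> \<partial>P) = (\<integral>\<omega>. f \<omega> * real_cond_exp P (F t) (Y T) \<omega> \<partial>P)"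
    using S.real_cond_exp_intg(2)[OF fi[OF T] f] by simp
  also have "\<dots> = (\<integral>\<omega>. f \<omega> * Y t \<omega> \<partial>P)"
    using ce by (intro integral_cong_AE) auto
  finally show "(\<integral>\<omega>. f \<omega> * Y t \<omega> \<partial>P) = (\<integral>\<omega>. f \<omega> * Y T \<omega> \<partial>P)" by simp
qed

text \<open>On the cell \<open>G j\<close> the rounded time is the constant \<open>s j\<close>, and
  both the cell and the weight \<open>\<phi> (Y (s j))\<close> are measurable at that time. The
  martingale property therefore replaces \<open>Y (s j)\<close> by \<open>Y T\<close> cell by cell,
  and the finitely many cells are summed.\<close>

lemma discrete_optional_stopping:
  assumes mart: "martingale P F T Y" and \<rho>: "bounded_stopping_time \<rho>"
    and \<phi>[measurable]: "\<phi> \<in> borel_measurable borel" and bnd: "\<And>y. \<bar>\<phi> y\<bar> \<le> (1::real)"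
  defines "h \<equiv> \<lambda>m \<omega>. Y (grid_ceil T m (\<rho> \<omega>)) \<omega>"
  shows "(\<integral>\<omega>. \<phi> (h m \<omega>) * h m \<omega> \<partial>P) = (\<integral>\<omega>. \<phi> (h m \<omega>) * Y T \<omega> \<partial>P)"
proof -
  let ?n = "real (Suc m)"
  define J where "J = {0..\<lceil>T * ?n\<rceil>}"
  define s where "s = (\<lambda>j::int. min T (real_of_int j / ?n))"
  define G where "G = (\<lambda>j::int. {\<omega>\<in>space P. \<lceil>\<rho> \<omega> * ?n\<rceil> = j})"
  have npos: "?n > 0" by simp
  have s_mem: "s j \<in> {0..T}" if "j \<in> J" for j using that T_nonneg by (auto simp: s_def J_def)
  \<comment> \<open>The ceiling is \<open>j\<close> exactly when \<open>\<rho>\<close> lies in the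
    half-open interval from \<open>(j - 1) / ?n\<close> to \<open>j / ?n\<close>, so the cell is a
    difference of two stopping events.\<close>
  have G_eq: "G j = {\<omega>\<in>space P. \<rho> \<omega> \<le> j / ?n} - {\<omega>\<in>space P. \<rho> \<omega> \<le> (j - 1) / ?n}" for j
    using npos by (auto simp: G_def ceiling_eq_iff pos_le_divide_eq simp del: of_nat_Suc)
  have stF: "{\<omega>\<in>space P. \<rho> \<omega> \<le> r} \<in> sets (F t)" if "r \<le> t" for r t
    using stopping_time_le_const[OF _ that, of \<rho>] \<rho> by (auto simp: bounded_stopping_time_def pred_def space_F)
  have G_F: "G j \<in> sets (F (s j))" if "j \<in> J" for j
  proof (cases "j / ?n \<le> T")
    case True
    then have "s j = j / ?n" by (simp add: s_def)
    then show ?thesis unfolding G_eq by (intro sets.Diff stF) (auto simp: divide_simps)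
  next
    \<comment> \<open>A cell whose right end exceeds \<open>T\<close> is assigned the time
      \<open>T\<close>, where measurability with respect to \<open>P\<close> suffices.\<close>
    case False
    then have "s j = T" by (simp add: s_def)
    moreover have "G j \<in> sets P" using bounded_stopping_time_measurable[OF \<rho>] unfolding G_def by measurable
    ultimately show ?thesis by (simp add: sets_F_T)
  qed
  have Ys: "Y (s j) \<in> borel_measurable (F (s j))" if "j \<in> J" for j
    using mart s_mem[OF that] by (auto simp: martingale_def adapted_process_def)
  let ?f = "\<lambda>j \<omega>. indicator (G j) \<omega> * \<phi> (Y (s j) \<omega>)"
  have f: "?f j \<in> borel_measurable (F (s j))" if "j \<in> J" for j
    using G_F[OF that] Ys[OF that] by measurable
  have fb: "\<bar>?f j \<omega>\<bar> \<le> 1" for j \<omega> using bnd by (auto simp: indicator_def)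
  have intT: "integrable P (Y T)" using mart T_nonneg by (auto simp: martingale_def)
  \<comment> \<open>Each path lies in exactly one cell, hence any value equals a sum over
    \<open>J\<close> with a single active term. This turns both integrands into finite sums.\<close>
  have split: "\<psi> = (\<Sum>j\<in>J. if \<omega> \<in> G j then \<psi> else 0)" if "\<omega> \<in> space P" for \<omega> and \<psi> :: real
  proof -
    have "0 \<le> \<rho> \<omega> * ?n" "\<rho> \<omega> * ?n \<le> T * ?n"
      using bounded_stopping_time_mem[OF \<rho> that] by (auto intro!: mult_right_mono simp del: of_nat_Suc)
    then have "\<lceil>\<rho> \<omega> * ?n\<rceil> \<in> J"
      unfolding J_def atLeastAtMost_iff
      using ceiling_mono[of 0 "\<rho> \<omega> * ?n"] ceiling_mono[of "\<rho> \<omega> * ?n" "T * ?n"] by simp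
    moreover have "(\<omega> \<in> G j) = (j = \<lceil>\<rho> \<omega> * ?n\<rceil>)" for j using that by (auto simp: G_def)
    ultimately show ?thesis by (simp add: J_def)
  qed
  have hG: "h m \<omega> = Y (s j) \<omega>" if "\<omega> \<in> G j" for j \<omega>
    using that by (auto simp: h_def G_def s_def grid_ceil_def)
  have "(\<integral>\<omega>. \<phi> (h m \<omega>) * h m \<omega> \<partial>P) = (\<integral>\<omega>. (\<Sum>j\<in>J. ?f j \<omega> * Y (s j) \<omega>) \<partial>P)"
    by (intro Bochner_Integration.integral_cong refl, subst split, assumption)
       (auto intro!: sum.cong simp: hG)
  also have "\<dots> = (\<Sum>j\<in>J. \<integral>\<omega>. ?f j \<omega> * Y (s j) \<omega> \<partial>P)"
    by (intro Bochner_Integration.integral_sum martingale_weighted(1)[OF mart s_mem f fb])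
  also have "\<dots> = (\<Sum>j\<in>J. \<integral>\<omega>. ?f j \<omega> * Y T \<omega> \<partial>P)"
    by (intro sum.cong refl martingale_weighted(2)[OF mart s_mem f fb])
  also have "\<dots> = (\<integral>\<omega>. (\<Sum>j\<in>J. ?f j \<omega> * Y T \<omega>) \<partial>P)"
  proof (intro Bochner_Integration.integral_sum[symmetric] Bochner_Integration.integrable_bound[OF intT])
    fix j assume j: "j \<in> J"
    have "?f j \<in> borel_measurable P" using f[OF j] s_mem[OF j] by (auto intro!: measurable_F_P)
    then show "(\<lambda>\<omega>. ?f j \<omega> * Y T \<omega>) \<in> borel_measurable P" using intT by measurable
    show "AE \<omega> in P. norm (?f j \<omega> * Y T \<omega>) \<le> norm (Y T \<omega>)"
    proof (intro AE_I2)
      fix \<omega> show "norm (?f j \<omega> * Y T \<omega>) \<le> norm (Y T \<omega>)"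
        using mult_left_le_one_le[of "\<bar>Y T \<omega>\<bar>" "\<bar>?f j \<omega>\<bar>"] fb[of j \<omega>]
        by (metis abs_ge_zero abs_mult real_norm_def)
    qed
  qed
  also have "\<dots> = (\<integral>\<omega>. \<phi> (h m \<omega>) * Y T \<omega> \<partial>P)"
    by (intro Bochner_Integration.integral_cong refl, subst (2) split, assumption)
       (auto intro!: sum.cong simp: hG)
  finally show ?thesis .
qed

text \<open>Two limits are taken. For a fixed localizing time the grid is refined, which gives
  expectation zero at \<open>min (\<rho> \<omega>) (\<tau> k \<omega>)\<close>; then
  \<open>k\<close> tends to infinity under the bound \<open>C\<close>. The martingale property is
  used for \<open>X\<close>, path limits for its regular version \<open>X'\<close>.\<close>

lemma optional_stopping:
  assumes clm: "continuous_local_martingale P F T X" and X': "continuous_process X'"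
    and ae: "AE \<omega> in P. \<forall>t\<in>{0..T}. X t \<omega> = X' t \<omega>" and zero: "\<And>\<omega>. \<omega> \<in> space P \<Longrightarrow> X' 0 \<omega> = 0"
    and \<rho>: "bounded_stopping_time \<rho>" and bnd: "\<And>\<omega> t. \<omega> \<in> space P \<Longrightarrow> t \<in> {0..\<rho> \<omega>} \<Longrightarrow> \<bar>X' t \<omega>\<bar> \<le> C"
  shows "(\<integral>\<omega>. X' (\<rho> \<omega>) \<omega> \<partial>P) = 0"
proof -
  obtain \<tau> :: "nat \<Rightarrow> 'a \<Rightarrow> real" where st: "\<And>k. bounded_stopping_time (\<tau> k)"
    and ev: "AE \<omega> in P. \<forall>\<^sub>F k in sequentially. \<tau> k \<omega> = T"
    and mart: "\<And>k. martingale P F T (\<lambda>t \<omega>. X (min t (\<tau> k \<omega>)) \<omega>)"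
    using clm unfolding continuous_local_martingale_def bounded_stopping_time_def image_subset_iff by auto
  note mem = bounded_stopping_time_mem[OF \<rho>]
  have cont: "continuous_on {0..T} (\<lambda>t. X' t \<omega>)" if "\<omega> \<in> space P" for \<omega> using X' that by (auto simp: continuous_process_def)
  \<comment> \<open>The maximum with \<open>1\<close> makes the truncation level positive whatever
    the sign of \<open>C\<close>, so that the quotient in \<open>\<phi>\<close> is
    continuous.\<close>
  define D where "D = max C 1"
  have D: "D \<ge> C" "D > 0" by (auto simp: D_def)
  \<comment> \<open>The weight \<open>\<phi>\<close> replaces uniform integrability of the discretely stopped values: \<open>\<phi> y * y\<close> is
    bounded, and in the limit \<open>\<phi>\<close> takes the value \<open>1\<close> because the limit is bounded by \<open>D\<close>.\<close>
  define \<phi> :: "real \<Rightarrow> real" where "\<phi> y = D / max D \<bar>y\<bar>" for y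
  have cphi: "continuous_on UNIV \<phi>" unfolding \<phi>_def using D by (intro continuous_intros) auto
  then have phiM[measurable]: "\<phi> \<in> borel_measurable borel" by (rule borel_measurable_continuous_onI)
  have phi1: "\<bar>\<phi> y\<bar> \<le> 1" for y using D by (auto simp: \<phi>_def)
  have phiD: "\<bar>\<phi> y * y\<bar> \<le> D" for y
    using D by (auto simp: \<phi>_def abs_mult divide_simps max_def)
  have phi_id: "\<phi> y = 1" if "\<bar>y\<bar> \<le> D" for y using that D by (auto simp: \<phi>_def max_def)
  have main: "(\<integral>\<omega>. X' (min (\<rho> \<omega>) (\<tau> k \<omega>)) \<omega> \<partial>P) = 0" for k
  proof -
    let ?Y = "\<lambda>t \<omega>. X (min t (\<tau> k \<omega>)) \<omega>"
    let ?h = "\<lambda>m \<omega>. ?Y (grid_ceil T m (\<rho> \<omega>)) \<omega>"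
    let ?L = "\<lambda>\<omega>. X' (min (\<rho> \<omega>) (\<tau> k \<omega>)) \<omega>"
    have stm: "bounded_stopping_time (\<lambda>\<omega>. min (\<rho> \<omega>) (\<tau> k \<omega>))" by (intro bounded_stopping_time_min \<rho> st)
    have L[measurable]: "?L \<in> borel_measurable P"
      by (rule measurable_at_time[OF X' bounded_stopping_time_measurable[OF stm] bounded_stopping_time_mem[OF stm]])
    have Lb: "\<bar>?L \<omega>\<bar> \<le> D" if "\<omega> \<in> space P" for \<omega>
      using bnd[OF that, of "min (\<rho> \<omega>) (\<tau> k \<omega>)"] bounded_stopping_time_mem[OF stm that] D by auto
    have intY: "integrable P (?Y t)" if "t \<in> {0..T}" for t
      using mart[of k] that by (auto simp: martingale_def)
    have h[measurable]: "?h m \<in> borel_measurable P" for m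
      using intY by (intro grid_measurable[of ?Y] bounded_stopping_time_measurable[OF \<rho>] mem) auto
    have lim: "AE \<omega> in P. (\<lambda>m. ?h m \<omega>) \<longlonglongrightarrow> ?L \<omega>"
      using ae
    proof (rule AE_mp, intro AE_I2 impI)
      fix \<omega> assume \<omega>: "\<omega> \<in> space P" and eq: "\<forall>t\<in>{0..T}. X t \<omega> = X' t \<omega>"
      have t: "min (grid_ceil T m (\<rho> \<omega>)) (\<tau> k \<omega>) \<in> {0..T}" for m
        using grid_ceil_mem[OF mem[OF \<omega>], of m] bounded_stopping_time_mem[OF st \<omega>, of k] by auto
      have "(\<lambda>m. X' (min (grid_ceil T m (\<rho> \<omega>)) (\<tau> k \<omega>)) \<omega>) \<longlonglongrightarrow> ?L \<omega>"
        using mem[OF \<omega>] t bounded_stopping_time_mem[OF stm \<omega>]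
        by (intro continuous_on_tendsto_compose[OF cont[OF \<omega>]] tendsto_min grid_ceil_tendsto tendsto_const) auto
      then show "(\<lambda>m. ?h m \<omega>) \<longlonglongrightarrow> ?L \<omega>" using eq t by simp
    qed
    have YT: "integrable P (?Y T)" using intY T_nonneg by auto
    have phil: "(\<lambda>m. \<phi> (f m)) \<longlonglongrightarrow> \<phi> l" if "f \<longlonglongrightarrow> l" for f l
      using continuous_on_tendsto_compose[OF cphi that] by auto
    have eq: "(\<integral>\<omega>. \<phi> (?h m \<omega>) * ?h m \<omega> \<partial>P) = (\<integral>\<omega>. \<phi> (?h m \<omega>) * ?Y T \<omega> \<partial>P)" for m
      by (rule discrete_optional_stopping[OF mart \<rho> phiM phi1])
    have "(\<lambda>m. \<integral>\<omega>. \<phi> (?h m \<omega>) * ?h m \<omega> \<partial>P) \<longlonglongrightarrow> (\<integral>\<omega>. \<phi> (?L \<omega>) * ?L \<omega> \<partial>P)"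
    proof (rule integral_dominated_convergence[where w = "\<lambda>_. D"])
      show "AE \<omega> in P. (\<lambda>m. \<phi> (?h m \<omega>) * ?h m \<omega>) \<longlonglongrightarrow> \<phi> (?L \<omega>) * ?L \<omega>"
        using lim by eventually_elim (intro tendsto_mult phil)
    qed (use phiD in auto)
    moreover have "(\<lambda>m. \<integral>\<omega>. \<phi> (?h m \<omega>) * ?Y T \<omega> \<partial>P) \<longlonglongrightarrow> (\<integral>\<omega>. \<phi> (?L \<omega>) * ?Y T \<omega> \<partial>P)"
    proof (rule integral_dominated_convergence[where w = "\<lambda>\<omega>. \<bar>?Y T \<omega>\<bar>"])
      show "AE \<omega> in P. (\<lambda>m. \<phi> (?h m \<omega>) * ?Y T \<omega>) \<longlonglongrightarrow> \<phi> (?L \<omega>) * ?Y T \<omega>"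
        using lim by eventually_elim (intro tendsto_mult phil tendsto_const)
      show "AE \<omega> in P. norm (\<phi> (?h m \<omega>) * ?Y T \<omega>) \<le> \<bar>?Y T \<omega>\<bar>" for m
        using phi1 by (auto simp: abs_mult intro!: mult_left_le_one_le)
      show "(\<lambda>\<omega>. \<phi> (?L \<omega>) * ?Y T \<omega>) \<in> borel_measurable P"
        using YT by measurable
      show "(\<lambda>\<omega>. \<phi> (?h m \<omega>) * ?Y T \<omega>) \<in> borel_measurable P" for m
        using borel_measurable_integrable[OF YT] by measurable
    qed (use YT in auto)
    ultimately have "(\<integral>\<omega>. \<phi> (?L \<omega>) * ?L \<omega> \<partial>P) = (\<integral>\<omega>. \<phi> (?L \<omega>) * ?Y T \<omega> \<partial>P)"
      unfolding eq using LIMSEQ_unique by blast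
    moreover have "(\<integral>\<omega>. \<phi> (?L \<omega>) * ?L \<omega> \<partial>P) = (\<integral>\<omega>. ?L \<omega> \<partial>P)"
      using Lb phi_id by (intro Bochner_Integration.integral_cong) auto
    moreover have "(\<integral>\<omega>. \<phi> (?L \<omega>) * ?Y T \<omega> \<partial>P) = (\<integral>\<omega>. ?Y T \<omega> \<partial>P)"
      using Lb phi_id by (intro Bochner_Integration.integral_cong) auto
    \<comment> \<open>The expectation of the localized martingale is constant in time: this is the
      weighted identity at time \<open>0\<close> with weight \<open>1\<close>.\<close>
    moreover have "(\<integral>\<omega>. ?Y T \<omega> \<partial>P) = (\<integral>\<omega>. ?Y 0 \<omega> \<partial>P)"
      using martingale_weighted(2)[OF mart[of k], of 0 "\<lambda>_. 1"] T_nonneg by simp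
    moreover have "(\<integral>\<omega>. ?Y 0 \<omega> \<partial>P) = 0"
    proof (rule integral_eq_zero_AE)
      show "AE \<omega> in P. ?Y 0 \<omega> = 0"
        using ae AE_space
      proof eventually_elim
        case (elim \<omega>)
        then show ?case using bounded_stopping_time_mem[OF st, of \<omega> k] zero T_nonneg by (auto simp: min_def)
      qed
    qed
    ultimately show ?thesis by simp
  qed
  have "(\<lambda>k. \<integral>\<omega>. X' (min (\<rho> \<omega>) (\<tau> k \<omega>)) \<omega> \<partial>P) \<longlonglongrightarrow> (\<integral>\<omega>. X' (\<rho> \<omega>) \<omega> \<partial>P)"
  proof (rule integral_dominated_convergence[where w = "\<lambda>_. C"])
    show "(\<lambda>\<omega>. X' (\<rho> \<omega>) \<omega>) \<in> borel_measurable P"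
      by (rule measurable_at_time[OF X' bounded_stopping_time_measurable[OF \<rho>] mem])
    have stm: "bounded_stopping_time (\<lambda>\<omega>. min (\<rho> \<omega>) (\<tau> k \<omega>))" for k by (intro bounded_stopping_time_min \<rho> st)
    show "(\<lambda>\<omega>. X' (min (\<rho> \<omega>) (\<tau> k \<omega>)) \<omega>) \<in> borel_measurable P" for k
      by (rule measurable_at_time[OF X' bounded_stopping_time_measurable[OF stm] bounded_stopping_time_mem[OF stm]])
    show "AE \<omega> in P. norm (X' (min (\<rho> \<omega>) (\<tau> k \<omega>)) \<omega>) \<le> C" for k
      using bounded_stopping_time_mem[OF stm, of _ k] bnd by (auto intro!: AE_I2)
    show "AE \<omega> in P. (\<lambda>k. X' (min (\<rho> \<omega>) (\<tau> k \<omega>)) \<omega>) \<longlonglongrightarrow> X' (\<rho> \<omega>) \<omega>"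
      using ev AE_space
    proof eventually_elim
      case (elim \<omega>)
      \<comment> \<open>Once \<open>\<tau> k\<close> equals \<open>T\<close>, it no longer lowers
        \<open>\<rho>\<close>; the sequence is eventually constant.\<close>
      then have "\<forall>\<^sub>F k in sequentially. X' (min (\<rho> \<omega>) (\<tau> k \<omega>)) \<omega> = X' (\<rho> \<omega>) \<omega>"
        using mem[of \<omega>] by (auto elim!: eventually_mono)
      then show ?case by (rule tendsto_eventually)
    qed
  qed auto
  then show ?thesis using main LIMSEQ_unique[OF tendsto_const, of 0] by auto
qed

end

subsection \<open>Running suprema and hitting times\<close>

lemma Sup_attained_Icc:
  fixes f :: "real \<Rightarrow> real"
  assumes "continuous_on {0..T} f" "t \<in> {0..T}"
  obtains s where "s \<in> {0..t}" "Sup (f ` {0..t}) = f s" "\<And>u. u \<in> {0..t} \<Longrightarrow> f u \<le> f s"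
proof -
  have "continuous_on {0..t} f" using assms by (auto intro: continuous_on_subset)
  then obtain s where s: "s \<in> {0..t}" "\<And>u. u \<in> {0..t} \<Longrightarrow> f u \<le> f s"
    using continuous_attains_sup[of "{0..t}" f] assms(2) by auto
  moreover have "Sup (f ` {0..t}) = f s" using s by (intro cSup_eq_maximum) auto
  ultimately show ?thesis using that by auto
qed

text \<open>A maximum over \<open>{0..y}\<close> is attained either before \<open>x\<close>, where
  it is at most the running supremum at \<open>x\<close>, or between \<open>x\<close> and
  \<open>y\<close>, where uniform continuity compares it with \<open>f x\<close>. The one-sided
  bound \<open>le\<close> is used with \<open>x\<close> and \<open>y\<close> in both orders.\<close>

lemma continuous_on_running_Sup:
  fixes f :: "real \<Rightarrow> real"
  assumes f: "continuous_on {0..T} f"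
  shows "continuous_on {0..T} (\<lambda>t. Sup (f ` {0..t}))"
proof -
  define g where "g t = Sup (f ` {0..t})" for t
  have ge: "f s \<le> g t" if "s \<in> {0..t}" "t \<in> {0..T}" for s t
    using Sup_attained_Icc[OF f that(2)] that(1) unfolding g_def by metis
  have uc: "uniformly_continuous_on {0..T} f"
    using f by (intro compact_uniformly_continuous) auto
  have "\<exists>d>0. \<forall>x\<in>{0..T}. \<forall>y\<in>{0..T}. dist y x < d \<longrightarrow> dist (g y) (g x) < e" if "e > 0" for e
  proof -
    obtain d where d: "d > 0"
      "\<And>x y. x \<in> {0..T} \<Longrightarrow> y \<in> {0..T} \<Longrightarrow> dist y x < d \<Longrightarrow> dist (f y) (f x) < e"
      using uc \<open>e > 0\<close> unfolding uniformly_continuous_on_def by metis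
    have le: "g y < g x + e" if xy: "x \<in> {0..T}" "y \<in> {0..T}" "dist y x < d" for x y
    proof -
      obtain s where s: "s \<in> {0..y}" "g y = f s"
        using Sup_attained_Icc[OF f xy(2)] unfolding g_def by metis
      show ?thesis
      proof (cases "s \<le> x")
        case True
        then show ?thesis using ge[of s x] s xy \<open>e > 0\<close> by auto
      next
        case False
        then have "dist (f s) (f x) < e" using d(2)[of x s] xy s by (auto simp: dist_real_def)
        then show ?thesis using ge[of x x] s xy by (auto simp: dist_real_def)
      qed
    qed
    have "dist (g y) (g x) < e" if "x \<in> {0..T}" "y \<in> {0..T}" "dist y x < d" for x y
      using le[of x y] le[of y x] that by (auto simp: dist_real_def dist_commute abs_less_iff)
    then show ?thesis using d(1) by metis
  qed
  then show ?thesis unfolding g_def[symmetric] continuous_on_iff by metis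
qed

text \<open>This density allows a bound on a continuous path over an interval to be tested at
  countably many times.\<close>

lemma closure_Rats_inter_Icc:
  fixes t :: real assumes "0 < t"
  shows "closure (\<rat> \<inter> {0..t}) = {0..t}"
proof
  show "closure (\<rat> \<inter> {0..t}) \<subseteq> {0..t}" by (intro closure_minimal) auto
  have "{0<..<t} \<subseteq> closure (\<rat> \<inter> {0..t})"
  proof
    fix x assume x: "x \<in> {0<..<t}"
    show "x \<in> closure (\<rat> \<inter> {0..t})" unfolding closure_approachable
    proof (intro allI impI)
      fix e :: real assume "e > 0"
      then obtain q where "q \<in> \<rat>" "x < q" "q < min t (x + e)"
        using Rats_dense_in_real[of x "min t (x + e)"] x by auto
      then show "\<exists>y\<in>\<rat> \<inter> {0..t}. dist y x < e" using x
        by (intro bexI[of _ q]) (auto simp: dist_real_def)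
    qed
  qed
  then have "closure {0<..<t} \<subseteq> closure (\<rat> \<inter> {0..t})" by (rule closure_minimal) simp
  then show "{0..t} \<subseteq> closure (\<rat> \<inter> {0..t})" using assms by simp
qed

context complete_filtered_space
begin

definition running_sup :: "(real \<Rightarrow> 'a \<Rightarrow> real) \<Rightarrow> real \<Rightarrow> 'a \<Rightarrow> real" where
  "running_sup Z t \<omega> = (SUP s\<in>{0..t}. Z s \<omega>)"

definition increasing_process :: "(real \<Rightarrow> 'a \<Rightarrow> real) \<Rightarrow> bool" where
  "increasing_process V \<longleftrightarrow> continuous_process V \<and> (\<forall>\<omega>\<in>space P. V 0 \<omega> = 0 \<and> mono_on {0..T} (\<lambda>t. V t \<omega>))"

lemma continuous_process_continuous: "continuous_process Z \<Longrightarrow> \<omega> \<in> space P \<Longrightarrow> continuous_on {0..T} (\<lambda>t. Z t \<omega>)"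
  by (simp add: continuous_process_def)

lemma continuous_process_adapted: "continuous_process Z \<Longrightarrow> t \<in> {0..T} \<Longrightarrow> Z t \<in> borel_measurable (F t)"
  by (simp add: continuous_process_def adapted_process_def)

lemma continuous_process_compose:
  assumes "continuous_process X" "continuous_on UNIV (g :: real \<Rightarrow> real)"
  shows "continuous_process (\<lambda>t \<omega>. g (X t \<omega>))"
  unfolding continuous_process_def adapted_process_def
proof (intro conjI ballI)
  show "(\<lambda>\<omega>. g (X t \<omega>)) \<in> borel_measurable (F t)" if "t \<in> {0..T}" for t
    using measurable_compose[OF continuous_process_adapted[OF assms(1) that] borel_measurable_continuous_onI[OF assms(2)]] .
  show "continuous_on {0..T} (\<lambda>t. g (X t \<omega>))" if "\<omega> \<in> space P" for \<omega>
    using continuous_on_compose2[OF assms(2) continuous_process_continuous[OF assms(1) that]] by auto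
qed

lemma continuous_process_sum:
  assumes "\<And>i. i \<in> I \<Longrightarrow> continuous_process (X i)"
  shows "continuous_process (\<lambda>t \<omega>. \<Sum>i\<in>I. X i t \<omega>)"
  using assms unfolding continuous_process_def adapted_process_def
  by (auto intro!: borel_measurable_sum continuous_on_sum)

lemma continuous_process_diff: "continuous_process X \<Longrightarrow> continuous_process Y \<Longrightarrow> continuous_process (\<lambda>t \<omega>. X t \<omega> - Y t \<omega>)"
  unfolding continuous_process_def adapted_process_def
  by (auto intro!: borel_measurable_diff continuous_on_diff)

lemma bounded_stopping_time_borel_measurable:
  "continuous_process X \<Longrightarrow> bounded_stopping_time \<rho> \<Longrightarrow> (\<lambda>\<omega>. X (\<rho> \<omega>) \<omega>) \<in> borel_measurable P"
  by (rule measurable_at_time[OF _ bounded_stopping_time_measurable bounded_stopping_time_mem])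

lemma running_sup_attained:
  assumes "continuous_process Z" "\<omega> \<in> space P" "t \<in> {0..T}"
  obtains s where "s \<in> {0..t}" "running_sup Z t \<omega> = Z s \<omega>" "\<And>u. u \<in> {0..t} \<Longrightarrow> Z u \<omega> \<le> Z s \<omega>"
  using Sup_attained_Icc[OF continuous_process_continuous[OF assms(1,2)] assms(3)] unfolding running_sup_def by metis

lemma running_sup_upper:
  assumes "continuous_process Z" "\<omega> \<in> space P" "t \<in> {0..T}" "s \<in> {0..t}"
  shows "Z s \<omega> \<le> running_sup Z t \<omega>"
  using running_sup_attained[OF assms(1-3)] assms(4) by metis

lemma running_sup_le_iff:
  assumes "continuous_process Z" "\<omega> \<in> space P" "t \<in> {0..T}"
  shows "running_sup Z t \<omega> \<le> a \<longleftrightarrow> (\<forall>s\<in>{0..t}. Z s \<omega> \<le> a)"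
proof
  show "\<forall>s\<in>{0..t}. Z s \<omega> \<le> a" if "running_sup Z t \<omega> \<le> a"
    using running_sup_upper[OF assms] that by fastforce
  show "running_sup Z t \<omega> \<le> a" if "\<forall>s\<in>{0..t}. Z s \<omega> \<le> a"
    using running_sup_attained[OF assms] that by metis
qed

text \<open>For adaptedness, the event that the supremum up to \<open>t\<close> is at most
  \<open>a\<close> is a countable intersection over rational times, since a weak inequality between
  continuous functions extends to the closure. The zero initial value of \<open>Z\<close> becomes
  that of the supremum.\<close>

lemma increasing_process_running_sup:
  assumes Z: "continuous_process Z" and Z0: "\<And>\<omega>. \<omega> \<in> space P \<Longrightarrow> Z 0 \<omega> = 0"
  shows "increasing_process (running_sup Z)"
proof -
  have "running_sup Z t \<in> borel_measurable (F t)" if t: "t \<in> {0..T}" for t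
  proof (cases "t = 0")
    case True
    then show ?thesis using continuous_process_adapted[OF Z t] by (simp add: running_sup_def[abs_def])
  next
    case False
    then have t0: "0 < t" using t by auto
    have meas: "Z s \<in> borel_measurable (F t)" if "s \<in> {0..t}" for s
      using that t by (intro measurable_F_mono[OF _ continuous_process_adapted[OF Z]]) auto
    show ?thesis unfolding borel_measurable_iff_le
    proof
      fix a
      have "{\<omega> \<in> space (F t). running_sup Z t \<omega> \<le> a} =
        {\<omega> \<in> space (F t). \<forall>s\<in>\<rat> \<inter> {0..t}. Z s \<omega> \<le> a}"
      proof (intro Collect_cong conj_cong refl)
        fix \<omega> assume "\<omega> \<in> space (F t)"
        then have \<omega>: "\<omega> \<in> space P" by (simp add: space_F)
        have c: "continuous_on (closure (\<rat> \<inter> {0..t})) (\<lambda>s. Z s \<omega>)"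
          unfolding closure_Rats_inter_Icc[OF t0] using continuous_process_continuous[OF Z \<omega>] t
          by (auto intro: continuous_on_subset)
        show "running_sup Z t \<omega> \<le> a \<longleftrightarrow> (\<forall>s\<in>\<rat> \<inter> {0..t}. Z s \<omega> \<le> a)"
          unfolding running_sup_le_iff[OF Z \<omega> t]
          using continuous_le_on_closure[OF c, of _ a] closure_Rats_inter_Icc[OF t0] by auto
      qed
      also have "\<dots> \<in> sets (F t)"
        proof (rule sets.sets_Collect_countable_All')
          show "{\<omega> \<in> space (F t). Z s \<omega> \<le> a} \<in> sets (F t)" if "s \<in> \<rat> \<inter> {0..t}" for s
            using meas[of s] that unfolding borel_measurable_iff_le by auto
        qed (simp add: countable_rat)
      finally show "{\<omega> \<in> space (F t). running_sup Z t \<omega> \<le> a} \<in> sets (F t)" .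
    qed
  qed
  moreover have "running_sup Z s \<omega> \<le> running_sup Z t \<omega>"
    if "\<omega> \<in> space P" "s \<in> {0..T}" "t \<in> {0..T}" "s \<le> t" for \<omega> s t
    using that running_sup_upper[OF Z that(1,3)] by (subst running_sup_le_iff[OF Z]) auto
  ultimately show ?thesis
    using Z0 continuous_on_running_Sup[OF continuous_process_continuous[OF Z]]
    by (auto simp: increasing_process_def continuous_process_def adapted_process_def running_sup_def monotone_on_def)
qed

lemma increasing_process_mono:
  "increasing_process V \<Longrightarrow> \<omega> \<in> space P \<Longrightarrow> 0 \<le> s \<Longrightarrow> s \<le> t \<Longrightarrow> t \<le> T \<Longrightarrow> V s \<omega> \<le> V t \<omega>"
  unfolding increasing_process_def monotone_on_def by auto

lemma increasing_process_nonneg: "increasing_process V \<Longrightarrow> \<omega> \<in> space P \<Longrightarrow> t \<in> {0..T} \<Longrightarrow> 0 \<le> V t \<omega>"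
  using increasing_process_mono[of V \<omega> 0 t] by (auto simp: increasing_process_def)

section \<open>Hitting times of increasing processes\<close>

text \<open>Inserting \<open>T\<close> keeps the infimum over a nonempty set and makes
  \<open>T\<close> the value on paths that never reach the level. Hitting time \<open>T\<close>
  alone therefore does not mean that the level is attained.\<close>

definition hitting_time :: "(real \<Rightarrow> 'a \<Rightarrow> real) \<Rightarrow> real \<Rightarrow> 'a \<Rightarrow> real" where
  "hitting_time V a \<omega> = Inf (insert T {t\<in>{0..T}. a \<le> V t \<omega>})"

lemma hitting_time_mem: "hitting_time V a \<omega> \<in> {0..T}"
  unfolding hitting_time_def using T_nonneg by (auto intro!: cInf_greatest cInf_lower bdd_belowI[of _ 0])

lemma hitting_time_lower: "t \<in> {0..T} \<Longrightarrow> a \<le> V t \<omega> \<Longrightarrow> hitting_time V a \<omega> \<le> t"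
  unfolding hitting_time_def using T_nonneg by (intro cInf_lower bdd_belowI[of _ 0]) auto

text \<open>The intermediate value theorem gives a time \<open>s\<close> with value exactly
  \<open>a\<close>. Closedness of the superlevel set gives a value of at least \<open>a\<close> at
  the infimum, and monotonicity gives at most \<open>V s \<omega> = a\<close>, because the infimum
  does not exceed \<open>s\<close>.\<close>

lemma hitting_time_eq:
  assumes V: "increasing_process V" and a: "0 < a" and \<omega>: "\<omega> \<in> space P" and t: "t \<in> {0..T}" "a \<le> V t \<omega>"
  shows "V (hitting_time V a \<omega>) \<omega> = a"
proof -
  have cont: "continuous_on {0..T} (\<lambda>t. V t \<omega>)" using V \<omega> by (simp add: increasing_process_def continuous_process_def)
  moreover from cont have "continuous_on {0..t} (\<lambda>t. V t \<omega>)"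
    by (rule continuous_on_subset) (use t in auto)
  ultimately obtain s where s: "0 \<le> s" "s \<le> t" "V s \<omega> = a"
    using IVT'[of "\<lambda>t. V t \<omega>" 0 a t] t a V \<omega>
    by (auto simp: increasing_process_def)
  have "closed {u\<in>{0..T}. a \<le> V u \<omega>}"
    using continuous_closed_preimage[OF cont, of "{a..}"]
    by (simp add: vimage_def Int_def conj_commute)
  then have "closed (insert T {u\<in>{0..T}. a \<le> V u \<omega>})" by (rule closed_insert)
  then have "hitting_time V a \<omega> \<in> insert T {u\<in>{0..T}. a \<le> V u \<omega>}"
    unfolding hitting_time_def using T_nonneg by (intro closed_contains_Inf bdd_belowI[of _ 0]) auto
  moreover have "hitting_time V a \<omega> \<le> s" using s t by (intro hitting_time_lower) auto
  ultimately have "a \<le> V (hitting_time V a \<omega>) \<omega>" using s t by (cases "s = T") auto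
  moreover have "V (hitting_time V a \<omega>) \<omega> \<le> V s \<omega>"
    using \<open>hitting_time V a \<omega> \<le> s\<close> hitting_time_mem[of V a \<omega>] s t by (intro increasing_process_mono[OF V \<omega>]) auto
  ultimately show ?thesis using s by simp
qed

lemma le_hitting_time:
  assumes "increasing_process V" "\<omega> \<in> space P" "t \<in> {0..T}" "V t \<omega> < a"
  shows "t \<le> hitting_time V a \<omega>"
  unfolding hitting_time_def
proof (rule cInf_greatest)
  fix x assume "x \<in> insert T {t \<in> {0..T}. a \<le> V t \<omega>}"
  then show "t \<le> x" using assms increasing_process_mono[OF assms(1,2), of x t] by force
qed auto

text \<open>A value above \<open>a\<close> at such a \<open>t\<close> would make \<open>t\<close>
  itself the hitting time, where the value is exactly \<open>a\<close>.\<close>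

lemma before_hitting_time:
  assumes "increasing_process V" "0 < a" "\<omega> \<in> space P" "0 \<le> t" "t \<le> hitting_time V a \<omega>"
  shows "V t \<omega> \<le> a"
proof (rule ccontr)
  assume n: "\<not> V t \<omega> \<le> a"
  have t: "t \<in> {0..T}" using assms hitting_time_mem[of V a \<omega>] by auto
  then have "hitting_time V a \<omega> = t" using hitting_time_lower[of t a V \<omega>] n assms by auto
  then show False using hitting_time_eq[OF assms(1-3) t] n by auto
qed

text \<open>For \<open>t\<close> in \<open>{0..<T}\<close> the level has been hit by time
  \<open>t\<close> exactly when \<open>a \<le> V t \<omega>\<close>, an event observed at time
  \<open>t\<close>. If \<open>V t \<omega> < a\<close>, continuity keeps the path below
  \<open>a\<close> slightly longer, so the hitting time is strictly later.\<close>

lemma bounded_stopping_time_hit: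
  assumes V: "increasing_process V"
  shows "bounded_stopping_time (hitting_time V a)"
  unfolding bounded_stopping_time_def
proof (intro conjI stopping_timeI)
  fix t
  show "Measurable.pred (F t) (\<lambda>\<omega>. hitting_time V a \<omega> \<le> t)"
  proof (cases "t \<in> {0..<T}")
    case True
    have "hitting_time V a \<omega> \<le> t \<longleftrightarrow> a \<le> V t \<omega>" if "\<omega> \<in> space (F t)" for \<omega>
    proof
      show "hitting_time V a \<omega> \<le> t" if "a \<le> V t \<omega>" using that True by (intro hitting_time_lower) auto
      assume h: "hitting_time V a \<omega> \<le> t"
      show "a \<le> V t \<omega>"
      proof (rule ccontr)
        assume n: "\<not> a \<le> V t \<omega>"
        have \<omega>: "\<omega> \<in> space P" using that by (simp add: space_F)
        have cont: "continuous_on {0..T} (\<lambda>t. V t \<omega>)" using V \<omega> by (simp add: increasing_process_def continuous_process_def)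
        obtain d where d: "d > 0" "\<And>s. s \<in> {0..T} \<Longrightarrow> dist s t < d \<Longrightarrow> dist (V s \<omega>) (V t \<omega>) < a - V t \<omega>"
          using cont n True unfolding continuous_on_iff
          by (metis atLeastAtMost_iff atLeastLessThan_iff diff_gt_0_iff_gt less_eq_real_def not_le)
        \<comment> \<open>This time is strictly later than \<open>t\<close> because
          \<open>t < T\<close>, and still close enough for the continuity estimate.\<close>
        define s where "s = min T (t + d / 2)"
        have s: "s \<in> {0..T}" "t < s" "dist s t < d" using True d(1) by (auto simp: s_def dist_real_def)
        have "V s \<omega> < a" using d(2)[OF s(1,3)] by (auto simp: dist_real_def)
        then show False using le_hitting_time[OF V \<omega> s(1), of a] s(2) h by linarith
      qed
    qed
    moreover have "Measurable.pred (F t) (\<lambda>\<omega>. a \<le> V t \<omega>)"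
      using continuous_process_adapted[of V t] V True by (auto simp: increasing_process_def)
    ultimately show ?thesis by (rule measurable_cong[THEN iffD2])
  next
    case False
    then consider "t < 0" | "T \<le> t" by force
    then show ?thesis
    proof cases
      case 1
      then have "(hitting_time V a \<omega> \<le> t) = False" for \<omega> using hitting_time_mem[of V a \<omega>] by auto
      then show ?thesis by simp
    next
      case 2
      then have "(hitting_time V a \<omega> \<le> t) = True" for \<omega> using hitting_time_mem[of V a \<omega>] by auto
      then show ?thesis by simp
    qed
  qed
qed (rule ballI, rule hitting_time_mem)

subsection \<open>Good-lambda inequalities\<close>

text \<open>
  The only consequence of the local martingale properties of \<open>M\<close> and \<open>M\<^sup>2 - A\<close> that the estimates use.
\<close>

definition qv_pair :: "(real \<Rightarrow> 'a \<Rightarrow> real) \<Rightarrow> (real \<Rightarrow> 'a \<Rightarrow> real) \<Rightarrow> bool" where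
  "qv_pair M A \<longleftrightarrow> continuous_process M \<and> (\<forall>\<omega>\<in>space P. M 0 \<omega> = 0) \<and> increasing_process A \<and>
     (\<forall>\<rho> C. bounded_stopping_time \<rho> \<longrightarrow> (\<forall>\<omega>\<in>space P. \<forall>t\<in>{0..\<rho> \<omega>}. \<bar>M t \<omega>\<bar> \<le> C \<and> A t \<omega> \<le> C) \<longrightarrow>
        (\<integral>\<omega>. M (\<rho> \<omega>) \<omega> \<partial>P) = 0 \<and> (\<integral>\<omega>. (M (\<rho> \<omega>) \<omega>)\<^sup>2 - A (\<rho> \<omega>) \<omega> \<partial>P) = 0)"

text \<open>The symmetry turns estimates for the one-sided supremum into estimates for the absolute
  value.\<close>

lemma qv_pair_uminus: "qv_pair M A \<Longrightarrow> qv_pair (\<lambda>t \<omega>. - M t \<omega>) A"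
  unfolding qv_pair_def by (auto intro!: continuous_process_compose[of M uminus] continuous_intros)

lemma qv_pair_stopped:
  assumes MA: "qv_pair M A" and \<rho>: "bounded_stopping_time \<rho>"
    and bnd: "\<And>\<omega>. \<omega> \<in> space P \<Longrightarrow> \<forall>t\<in>{0..\<rho> \<omega>}. \<bar>M t \<omega>\<bar> \<le> C \<and> A t \<omega> \<le> C"
  shows "integrable P (\<lambda>\<omega>. M (\<rho> \<omega>) \<omega>)" "integrable P (\<lambda>\<omega>. (M (\<rho> \<omega>) \<omega>)\<^sup>2)" "integrable P (\<lambda>\<omega>. A (\<rho> \<omega>) \<omega>)"
    "(\<integral>\<omega>. M (\<rho> \<omega>) \<omega> \<partial>P) = 0" "(\<integral>\<omega>. (M (\<rho> \<omega>) \<omega>)\<^sup>2 \<partial>P) = (\<integral>\<omega>. A (\<rho> \<omega>) \<omega> \<partial>P)"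
proof -
  have M: "continuous_process M" and A: "increasing_process A" "continuous_process A" using MA by (auto simp: qv_pair_def increasing_process_def)
  note [measurable] = bounded_stopping_time_borel_measurable[OF M \<rho>] bounded_stopping_time_borel_measurable[OF A(2) \<rho>]
  have b: "\<bar>M (\<rho> \<omega>) \<omega>\<bar> \<le> C" "A (\<rho> \<omega>) \<omega> \<le> C" "0 \<le> A (\<rho> \<omega>) \<omega>" if "\<omega> \<in> space P" for \<omega>
    using bnd[OF that] bounded_stopping_time_mem[OF \<rho> that] increasing_process_nonneg[OF A(1) that] by auto
  show 1: "integrable P (\<lambda>\<omega>. M (\<rho> \<omega>) \<omega>)"
    by (rule integrable_const_bound[where B = C]) (use b in auto)
  show 2: "integrable P (\<lambda>\<omega>. (M (\<rho> \<omega>) \<omega>)\<^sup>2)"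
    by (rule integrable_const_bound[where B = "C\<^sup>2"]) (use b(1) in \<open>auto intro!: AE_I2 simp: abs_le_square_iff[symmetric] intro: order_trans[OF _ abs_ge_self]\<close>)
  show 3: "integrable P (\<lambda>\<omega>. A (\<rho> \<omega>) \<omega>)"
    by (rule integrable_const_bound[where B = C]) (use b in auto)
  have "(\<integral>\<omega>. M (\<rho> \<omega>) \<omega> \<partial>P) = 0 \<and> (\<integral>\<omega>. (M (\<rho> \<omega>) \<omega>)\<^sup>2 - A (\<rho> \<omega>) \<omega> \<partial>P) = 0"
    using MA \<rho> bnd unfolding qv_pair_def by blast
  then show "(\<integral>\<omega>. M (\<rho> \<omega>) \<omega> \<partial>P) = 0" "(\<integral>\<omega>. (M (\<rho> \<omega>) \<omega>)\<^sup>2 \<partial>P) = (\<integral>\<omega>. A (\<rho> \<omega>) \<omega> \<partial>P)"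
    using 2 3 by auto
qed

text \<open>Let \<open>\<sigma>\<close> and \<open>\<rho>\<close> be the times at which the running
  maximum reaches \<open>l\<close> and \<open>b * l\<close>, both stopped at \<open>\<theta>\<close>
  and when \<open>A\<close> reaches \<open>d * l\<^sup>2\<close>. On \<open>?E\<close> the increment
  of \<open>M\<close> between them is \<open>(b - 1) * l\<close>. Its second moment is the expected
  increment of \<open>A\<close>, which is at most \<open>d * l\<^sup>2\<close> on \<open>?H\<close>
  and at most zero elsewhere.\<close>

lemma good_lambda_sup:
  assumes MA: "qv_pair M A" and \<theta>: "bounded_stopping_time \<theta>"
    and bnd: "\<And>\<omega>. \<omega> \<in> space P \<Longrightarrow> \<forall>t\<in>{0..\<theta> \<omega>}. \<bar>M t \<omega>\<bar> \<le> C \<and> A t \<omega> \<le> C"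
    and l: "0 < l" and b: "1 < b" and d: "0 < d"
  defines "V \<equiv> running_sup M"
  shows "(b - 1)\<^sup>2 * prob {\<omega>\<in>space P. b * l \<le> V (\<theta> \<omega>) \<omega> \<and> A (\<theta> \<omega>) \<omega> < d * l\<^sup>2}
         \<le> d * prob {\<omega>\<in>space P. l \<le> V (\<theta> \<omega>) \<omega>}" (is "_ * prob ?E \<le> d * prob ?H")
proof -
  have M: "continuous_process M" and A: "increasing_process A" "continuous_process A" and M0: "\<And>\<omega>. \<omega> \<in> space P \<Longrightarrow> M 0 \<omega> = 0"
    using MA by (auto simp: qv_pair_def increasing_process_def)
  have V: "increasing_process V" unfolding V_def by (intro increasing_process_running_sup M M0)
  then have Vc: "continuous_process V" by (simp add: increasing_process_def)
  have dl: "0 < d * l\<^sup>2" and bl: "0 < b * l" using d l b by auto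
  define \<tau> where "\<tau> = (\<lambda>\<omega>. min (hitting_time A (d * l\<^sup>2) \<omega>) (\<theta> \<omega>))"
  define \<rho> where "\<rho> = (\<lambda>\<omega>. min (hitting_time V (b * l) \<omega>) (\<tau> \<omega>))"
  define \<sigma> where "\<sigma> = (\<lambda>\<omega>. min (hitting_time V l \<omega>) (\<tau> \<omega>))"
  have st: "bounded_stopping_time \<rho>" "bounded_stopping_time \<sigma>" unfolding \<rho>_def \<sigma>_def \<tau>_def by (intro bounded_stopping_time_min bounded_stopping_time_hit V A \<theta>)+
  have le\<theta>: "\<rho> \<omega> \<le> \<theta> \<omega>" "\<sigma> \<omega> \<le> \<theta> \<omega>" for \<omega> by (auto simp: \<rho>_def \<sigma>_def \<tau>_def)
  have bnd': "\<forall>t\<in>{0..\<rho> \<omega>}. \<bar>M t \<omega>\<bar> \<le> C \<and> A t \<omega> \<le> C" "\<forall>t\<in>{0..\<sigma> \<omega>}. \<bar>M t \<omega>\<bar> \<le> C \<and> A t \<omega> \<le> C"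
    if "\<omega> \<in> space P" for \<omega> using bnd[OF that] le\<theta>[of \<omega>] by auto
  note I = qv_pair_stopped[OF MA st(1) bnd'(1)] and J = qv_pair_stopped[OF MA st(2) bnd'(2)]
  note [measurable] = bounded_stopping_time_borel_measurable[OF Vc \<theta>] bounded_stopping_time_borel_measurable[OF A(2) \<theta>]
  \<comment> \<open>The running supremum is attained at some \<open>s\<close> no later than the
    hitting time. The level \<open>a\<close> is already reached at \<open>s\<close>, so
    \<open>s\<close> is the hitting time and \<open>M\<close> itself has the value \<open>a\<close>
    there.\<close>
  have hitM: "M (hitting_time V a \<omega>) \<omega> = a" if \<omega>: "\<omega> \<in> space P" and t: "t \<in> {0..T}" "a \<le> V t \<omega>" "0 < a" for \<omega> a t
  proof -
    have eq: "V (hitting_time V a \<omega>) \<omega> = a" by (rule hitting_time_eq[OF V t(3) \<omega> t(1,2)])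
    obtain s where s: "s \<in> {0..hitting_time V a \<omega>}" "V (hitting_time V a \<omega>) \<omega> = M s \<omega>"
      using running_sup_attained[OF M \<omega> hitting_time_mem[of V a \<omega>]] unfolding V_def by metis
    have "s \<in> {0..T}" using s hitting_time_mem[of V a \<omega>] by auto
    then have "M s \<omega> \<le> V s \<omega>" unfolding V_def by (intro running_sup_upper[OF M \<omega>]) auto
    then have "hitting_time V a \<omega> \<le> s" using s eq \<open>s \<in> {0..T}\<close> by (intro hitting_time_lower) auto
    then show ?thesis using s eq by auto
  qed
  have intE: "integrable P (indicator ?E :: _ \<Rightarrow> real)" "integrable P (indicator ?H :: _ \<Rightarrow> real)"
    by (rule integrable_real_indicator; simp add: less_top[symmetric])+
  \<comment> \<open>Either the two times agree or \<open>M\<close> is exactly \<open>l\<close> at the first one, so that \<open>l\<close> may replace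
    the random factor \<open>M (\<sigma> \<omega>) \<omega>\<close> in the cross term of the square.\<close>
  have square: "(M (\<rho> \<omega>) \<omega> - M (\<sigma> \<omega>) \<omega>)\<^sup>2 =
      (M (\<rho> \<omega>) \<omega>)\<^sup>2 - (M (\<sigma> \<omega>) \<omega>)\<^sup>2 - 2 * l * (M (\<rho> \<omega>) \<omega> - M (\<sigma> \<omega>) \<omega>)"
    and incr: "A (\<rho> \<omega>) \<omega> - A (\<sigma> \<omega>) \<omega> \<le> d * l\<^sup>2 * indicator ?H \<omega>" if \<omega>: "\<omega> \<in> space P" for \<omega>
  proof -
    have \<theta>T: "\<theta> \<omega> \<in> {0..T}" by (rule bounded_stopping_time_mem[OF \<theta> \<omega>])
    have disj: "\<rho> \<omega> = \<sigma> \<omega> \<or> \<sigma> \<omega> = hitting_time V l \<omega> \<and> hitting_time V l \<omega> < \<theta> \<omega> \<and> M (\<sigma> \<omega>) \<omega> = l \<and> l \<le> V (\<theta> \<omega>) \<omega>"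
    proof (cases "hitting_time V l \<omega> < \<tau> \<omega>")
      case True
      then have lt: "hitting_time V l \<omega> < \<theta> \<omega>" by (auto simp: \<tau>_def)
      have VL: "l \<le> V (\<theta> \<omega>) \<omega>"
        using le_hitting_time[OF V \<omega> \<theta>T, of l] lt by force
      then show ?thesis using hitM[OF \<omega> \<theta>T VL l] True lt by (auto simp: \<sigma>_def)
    next
      case False
      have "hitting_time V l \<omega> \<le> hitting_time V (b * l) \<omega>" unfolding hitting_time_def
        using b l T_nonneg by (intro cInf_superset_mono bdd_belowI[of _ 0])
          (auto intro: order_trans[of l "b * l"])
      then show ?thesis using False by (auto simp: \<rho>_def \<sigma>_def)
    qed
    then show "(M (\<rho> \<omega>) \<omega> - M (\<sigma> \<omega>) \<omega>)\<^sup>2 =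
      (M (\<rho> \<omega>) \<omega>)\<^sup>2 - (M (\<sigma> \<omega>) \<omega>)\<^sup>2 - 2 * l * (M (\<rho> \<omega>) \<omega> - M (\<sigma> \<omega>) \<omega>)"
      by (auto simp: power2_eq_square algebra_simps)
    have "A (\<rho> \<omega>) \<omega> \<le> d * l\<^sup>2"
      using bounded_stopping_time_mem[OF st(1) \<omega>] by (intro before_hitting_time[OF A(1) dl \<omega>]) (auto simp: \<rho>_def \<tau>_def)
    moreover have "0 \<le> A (\<sigma> \<omega>) \<omega>" by (rule increasing_process_nonneg[OF A(1) \<omega> bounded_stopping_time_mem[OF st(2) \<omega>]])
    ultimately show "A (\<rho> \<omega>) \<omega> - A (\<sigma> \<omega>) \<omega> \<le> d * l\<^sup>2 * indicator ?H \<omega>"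
      using disj \<omega> by (auto simp: indicator_def)
  qed
  have event: "((b - 1) * l)\<^sup>2 * indicator ?E \<omega> \<le> (M (\<rho> \<omega>) \<omega> - M (\<sigma> \<omega>) \<omega>)\<^sup>2" if \<omega>: "\<omega> \<in> space P" for \<omega>
  proof (cases "\<omega> \<in> ?E")
    case True
    have \<theta>T: "\<theta> \<omega> \<in> {0..T}" by (rule bounded_stopping_time_mem[OF \<theta> \<omega>])
    \<comment> \<open>On \<open>?E\<close> the stop through \<open>A\<close> does not act before
      \<open>\<theta>\<close>, so both levels of the maximum are really reached.\<close>
    have "\<tau> \<omega> = \<theta> \<omega>" using True le_hitting_time[OF A(1) \<omega> \<theta>T, of "d * l\<^sup>2"] by (auto simp: \<tau>_def)
    moreover have bl': "b * l \<le> V (\<theta> \<omega>) \<omega>" and l': "l \<le> V (\<theta> \<omega>) \<omega>"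
      using True b l by (auto intro: order_trans[of l "b * l"])
    ultimately have "\<rho> \<omega> = hitting_time V (b * l) \<omega>" "\<sigma> \<omega> = hitting_time V l \<omega>"
      using hitting_time_lower[of "\<theta> \<omega>" _ V \<omega>] \<theta>T by (auto simp: \<rho>_def \<sigma>_def)
    then have "M (\<rho> \<omega>) \<omega> = b * l" "M (\<sigma> \<omega>) \<omega> = l"
      using hitM[OF \<omega> \<theta>T bl' bl] hitM[OF \<omega> \<theta>T l' l] by auto
    then show ?thesis using True by (simp add: algebra_simps)
  qed simp
  have "((b - 1) * l)\<^sup>2 * prob ?E = (\<integral>\<omega>. ((b - 1) * l)\<^sup>2 * indicator ?E \<omega> \<partial>P)" by simp
  also have "\<dots> \<le> (\<integral>\<omega>. (M (\<rho> \<omega>) \<omega> - M (\<sigma> \<omega>) \<omega>)\<^sup>2 \<partial>P)"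
  proof (rule integral_mono)
    have "integrable P (\<lambda>\<omega>. (M (\<rho> \<omega>) \<omega>)\<^sup>2 - (M (\<sigma> \<omega>) \<omega>)\<^sup>2 - 2 * l * (M (\<rho> \<omega>) \<omega> - M (\<sigma> \<omega>) \<omega>))"
      using I J by auto
    then show "integrable P (\<lambda>\<omega>. (M (\<rho> \<omega>) \<omega> - M (\<sigma> \<omega>) \<omega>)\<^sup>2)"
      using square by (subst Bochner_Integration.integrable_cong[OF refl]) auto
  qed (use event intE in auto)
  also have "\<dots> = (\<integral>\<omega>. (M (\<rho> \<omega>) \<omega>)\<^sup>2 - (M (\<sigma> \<omega>) \<omega>)\<^sup>2 - 2 * l * (M (\<rho> \<omega>) \<omega> - M (\<sigma> \<omega>) \<omega>) \<partial>P)"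
    using square by (intro Bochner_Integration.integral_cong) auto
  also have "\<dots> = (\<integral>\<omega>. A (\<rho> \<omega>) \<omega> - A (\<sigma> \<omega>) \<omega> \<partial>P)" using I J by simp
  also have "\<dots> \<le> (\<integral>\<omega>. d * l\<^sup>2 * indicator ?H \<omega> \<partial>P)"
    using I J incr intE by (intro integral_mono) auto
  also have "\<dots> = d * l\<^sup>2 * prob ?H" by simp
  finally show ?thesis using l by (simp add: power_mult_distrib mult.assoc mult.left_commute)
qed

text \<open>The roles of \<open>M\<close> and \<open>A\<close> are exchanged. On \<open>?E\<close>
  the increment of \<open>A\<close> between the levels \<open>l\<^sup>2\<close> and
  \<open>b * l\<^sup>2\<close> is \<open>(b - 1) * l\<^sup>2\<close>. Its expectation is that of the
  increment of the square of \<open>M\<close>, which is at most \<open>(d * l)\<^sup>2\<close> on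
  \<open>?H\<close> because \<open>\<rho>\<close> comes no later than the time at which
  \<open>W\<close> reaches \<open>d * l\<close>.\<close>

lemma good_lambda_qv:
  assumes MA: "qv_pair M A" and \<theta>: "bounded_stopping_time \<theta>"
    and bnd: "\<And>\<omega>. \<omega> \<in> space P \<Longrightarrow> \<forall>t\<in>{0..\<theta> \<omega>}. \<bar>M t \<omega>\<bar> \<le> C \<and> A t \<omega> \<le> C"
    and l: "0 < l" and b: "1 < b" and d: "0 < d"
  defines "W \<equiv> running_sup (\<lambda>t \<omega>. \<bar>M t \<omega>\<bar>)"
  shows "(b - 1) * prob {\<omega>\<in>space P. b * l\<^sup>2 \<le> A (\<theta> \<omega>) \<omega> \<and> W (\<theta> \<omega>) \<omega> < d * l}
         \<le> d\<^sup>2 * prob {\<omega>\<in>space P. l\<^sup>2 \<le> A (\<theta> \<omega>) \<omega>}" (is "_ * prob ?E \<le> _ * prob ?H")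
proof -
  have M: "continuous_process M" and A: "increasing_process A" "continuous_process A" and M0: "\<And>\<omega>. \<omega> \<in> space P \<Longrightarrow> M 0 \<omega> = 0"
    using MA by (auto simp: qv_pair_def increasing_process_def)
  have absM: "continuous_process (\<lambda>t \<omega>. \<bar>M t \<omega>\<bar>)" by (intro continuous_process_compose[OF M] continuous_intros)
  have W: "increasing_process W" unfolding W_def by (intro increasing_process_running_sup absM) (use M0 in auto)
  then have Wc: "continuous_process W" by (simp add: increasing_process_def)
  have dl: "0 < d * l" and l2: "0 < l\<^sup>2" and bl: "0 < b * l\<^sup>2" using d l b by auto
  define \<tau> where "\<tau> = (\<lambda>\<omega>. min (hitting_time W (d * l) \<omega>) (\<theta> \<omega>))"
  define \<rho> where "\<rho> = (\<lambda>\<omega>. min (hitting_time A (b * l\<^sup>2) \<omega>) (\<tau> \<omega>))"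
  define \<sigma> where "\<sigma> = (\<lambda>\<omega>. min (hitting_time A (l\<^sup>2) \<omega>) (\<tau> \<omega>))"
  have st: "bounded_stopping_time \<rho>" "bounded_stopping_time \<sigma>" unfolding \<rho>_def \<sigma>_def \<tau>_def by (intro bounded_stopping_time_min bounded_stopping_time_hit W A \<theta>)+
  have le\<theta>: "\<rho> \<omega> \<le> \<theta> \<omega>" "\<sigma> \<omega> \<le> \<theta> \<omega>" for \<omega> by (auto simp: \<rho>_def \<sigma>_def \<tau>_def)
  have bnd': "\<forall>t\<in>{0..\<rho> \<omega>}. \<bar>M t \<omega>\<bar> \<le> C \<and> A t \<omega> \<le> C" "\<forall>t\<in>{0..\<sigma> \<omega>}. \<bar>M t \<omega>\<bar> \<le> C \<and> A t \<omega> \<le> C"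
    if "\<omega> \<in> space P" for \<omega> using bnd[OF that] le\<theta>[of \<omega>] by auto
  note I = qv_pair_stopped[OF MA st(1) bnd'(1)] and J = qv_pair_stopped[OF MA st(2) bnd'(2)]
  note [measurable] = bounded_stopping_time_borel_measurable[OF Wc \<theta>] bounded_stopping_time_borel_measurable[OF A(2) \<theta>]
  have intE: "integrable P (indicator ?E :: _ \<Rightarrow> real)" "integrable P (indicator ?H :: _ \<Rightarrow> real)"
    by (rule integrable_real_indicator; simp add: less_top[symmetric])+
  have hit_le: "hitting_time A (l\<^sup>2) \<omega> \<le> hitting_time A (b * l\<^sup>2) \<omega>" for \<omega>
    unfolding hitting_time_def using b l T_nonneg by (intro cInf_superset_mono bdd_belowI[of _ 0])
      (auto intro: order_trans[of "l\<^sup>2" "b * l\<^sup>2"])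
  have incr: "(M (\<rho> \<omega>) \<omega>)\<^sup>2 - (M (\<sigma> \<omega>) \<omega>)\<^sup>2 \<le> (d * l)\<^sup>2 * indicator ?H \<omega>" if \<omega>: "\<omega> \<in> space P" for \<omega>
  proof (cases "hitting_time A (l\<^sup>2) \<omega> < \<tau> \<omega>")
    case True
    have \<theta>T: "\<theta> \<omega> \<in> {0..T}" by (rule bounded_stopping_time_mem[OF \<theta> \<omega>])
    have "hitting_time A (l\<^sup>2) \<omega> < \<theta> \<omega>" using True by (auto simp: \<tau>_def)
    then have H: "\<omega> \<in> ?H" using le_hitting_time[OF A(1) \<omega> \<theta>T, of "l\<^sup>2"] \<omega> by force
    have "\<bar>M (\<rho> \<omega>) \<omega>\<bar> \<le> W (\<rho> \<omega>) \<omega>"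
      unfolding W_def using bounded_stopping_time_mem[OF st(1) \<omega>] by (intro running_sup_upper[OF absM \<omega>]) auto
    also have "\<dots> \<le> d * l"
      using bounded_stopping_time_mem[OF st(1) \<omega>] by (intro before_hitting_time[OF W dl \<omega>]) (auto simp: \<rho>_def \<tau>_def)
    finally have "(M (\<rho> \<omega>) \<omega>)\<^sup>2 \<le> (d * l)\<^sup>2" using dl by (simp add: abs_le_square_iff[symmetric])
    \<comment> \<open>The square at \<open>\<sigma>\<close> enters with a favourable sign and is
      discarded.\<close>
    then have "(M (\<rho> \<omega>) \<omega>)\<^sup>2 \<le> (d * l)\<^sup>2 + (M (\<sigma> \<omega>) \<omega>)\<^sup>2" by (rule add_increasing2[rotated]) simp
    then show ?thesis using H by simp
  next
    case False
    then have "\<rho> \<omega> = \<sigma> \<omega>" using hit_le[of \<omega>] by (auto simp: \<rho>_def \<sigma>_def)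
    then show ?thesis by simp
  qed
  have event: "(b - 1) * l\<^sup>2 * indicator ?E \<omega> \<le> A (\<rho> \<omega>) \<omega> - A (\<sigma> \<omega>) \<omega>" if \<omega>: "\<omega> \<in> space P" for \<omega>
  proof (cases "\<omega> \<in> ?E")
    case True
    have \<theta>T: "\<theta> \<omega> \<in> {0..T}" by (rule bounded_stopping_time_mem[OF \<theta> \<omega>])
    have "\<tau> \<omega> = \<theta> \<omega>" using True le_hitting_time[OF W \<omega> \<theta>T, of "d * l"] by (auto simp: \<tau>_def)
    moreover have bl': "b * l\<^sup>2 \<le> A (\<theta> \<omega>) \<omega>" and l': "l\<^sup>2 \<le> A (\<theta> \<omega>) \<omega>"
      using True b l by (auto intro: order_trans[of "l\<^sup>2" "b * l\<^sup>2"])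
    ultimately have "\<rho> \<omega> = hitting_time A (b * l\<^sup>2) \<omega>" "\<sigma> \<omega> = hitting_time A (l\<^sup>2) \<omega>"
      using hitting_time_lower[of "\<theta> \<omega>" _ A \<omega>] \<theta>T by (auto simp: \<rho>_def \<sigma>_def)
    then have "A (\<rho> \<omega>) \<omega> = b * l\<^sup>2" "A (\<sigma> \<omega>) \<omega> = l\<^sup>2"
      using hitting_time_eq[OF A(1) bl \<omega> \<theta>T bl'] hitting_time_eq[OF A(1) l2 \<omega> \<theta>T l'] by auto
    then show ?thesis using True by (simp add: algebra_simps)
  next
    case False
    have "\<sigma> \<omega> \<le> \<rho> \<omega>" using hit_le[of \<omega>] by (auto simp: \<rho>_def \<sigma>_def)
    then have "A (\<sigma> \<omega>) \<omega> \<le> A (\<rho> \<omega>) \<omega>"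
      using bounded_stopping_time_mem[OF st(1) \<omega>] bounded_stopping_time_mem[OF st(2) \<omega>] by (intro increasing_process_mono[OF A(1) \<omega>]) auto
    then show ?thesis using False by simp
  qed
  have "(b - 1) * l\<^sup>2 * prob ?E = (\<integral>\<omega>. (b - 1) * l\<^sup>2 * indicator ?E \<omega> \<partial>P)" by simp
  also have "\<dots> \<le> (\<integral>\<omega>. A (\<rho> \<omega>) \<omega> - A (\<sigma> \<omega>) \<omega> \<partial>P)"
    using I J event intE by (intro integral_mono) auto
  also have "\<dots> = (\<integral>\<omega>. (M (\<rho> \<omega>) \<omega>)\<^sup>2 - (M (\<sigma> \<omega>) \<omega>)\<^sup>2 \<partial>P)" using I J by simp
  also have "\<dots> \<le> (\<integral>\<omega>. (d * l)\<^sup>2 * indicator ?H \<omega> \<partial>P)"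
    using I J incr intE by (intro integral_mono) auto
  also have "\<dots> = (d * l)\<^sup>2 * prob ?H" by simp
  finally show ?thesis using l by (simp add: power_mult_distrib mult.assoc mult.left_commute)
qed

section \<open>From tail estimates to moments\<close>

text \<open>The value \<open>f \<omega>\<close> is the length of the interval
  \<open>{0<..f \<omega>}\<close>; Tonelli's theorem exchanges the two integrals.\<close>

lemma layer_cake:
  assumes [measurable]: "f \<in> borel_measurable P" and nonneg: "\<And>\<omega>. \<omega> \<in> space P \<Longrightarrow> 0 \<le> f \<omega>"
  shows "(\<integral>\<^sup>+\<omega>. ennreal (f \<omega>) \<partial>P) =
    (\<integral>\<^sup>+u. indicator {0<..} u * emeasure P {\<omega>\<in>space P. u \<le> f \<omega>} \<partial>lborel)"
proof -
  interpret L: pair_sigma_finite P lborel by unfold_locales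
  have "(\<integral>\<^sup>+\<omega>. ennreal (f \<omega>) \<partial>P) = (\<integral>\<^sup>+\<omega>. (\<integral>\<^sup>+u. indicator {0<..f \<omega>} u \<partial>lborel) \<partial>P)"
    using nonneg by (intro nn_integral_cong) auto
  also have "\<dots> = (\<integral>\<^sup>+\<omega>. (\<integral>\<^sup>+u. (if 0 < u \<and> u \<le> f \<omega> then 1 else 0) \<partial>lborel) \<partial>P)"
    by (intro nn_integral_cong) (auto simp: indicator_def)
  also have "\<dots> = (\<integral>\<^sup>+u. (\<integral>\<^sup>+\<omega>. (if 0 < u \<and> u \<le> f \<omega> then 1 else 0) \<partial>P) \<partial>lborel)"
    by (rule L.Fubini'[symmetric]) measurable
  also have "\<dots> = (\<integral>\<^sup>+u. indicator {0<..} u * emeasure P {\<omega>\<in>space P. u \<le> f \<omega>} \<partial>lborel)"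
  proof (intro nn_integral_cong)
    fix u :: real
    have "(\<integral>\<^sup>+\<omega>. (if 0 < u \<and> u \<le> f \<omega> then 1 else 0) \<partial>P) =
      (\<integral>\<^sup>+\<omega>. indicator {0<..} u * indicator {\<omega>\<in>space P. u \<le> f \<omega>} \<omega> \<partial>P)"
      by (intro nn_integral_cong) (auto simp: indicator_def)
    then show "(\<integral>\<^sup>+\<omega>. (if 0 < u \<and> u \<le> f \<omega> then 1 else 0) \<partial>P) =
      indicator {0<..} u * emeasure P {\<omega>\<in>space P. u \<le> f \<omega>}"
      by (simp add: nn_integral_cmult)
  qed
  finally show ?thesis .
qed

text \<open>If \<open>b * u \<le> f\<close>, then either \<open>g\<close> is at least
  \<open>d * u\<close> or the good-lambda event occurs. Integrating the tails over \<open>u\<close>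
  gives \<open>E f / b \<le> E f / (2 * b) + E g / d\<close>; half of the left side absorbs the
  first term.\<close>

lemma good_lambda_moment:
  assumes [measurable]: "f \<in> borel_measurable P" "g \<in> borel_measurable P"
    and f: "\<And>\<omega>. \<omega> \<in> space P \<Longrightarrow> 0 \<le> f \<omega>" "\<And>\<omega>. \<omega> \<in> space P \<Longrightarrow> f \<omega> \<le> K"
    and g: "\<And>\<omega>. \<omega> \<in> space P \<Longrightarrow> 0 \<le> g \<omega>" "\<And>\<omega>. \<omega> \<in> space P \<Longrightarrow> g \<omega> \<le> K"
    and B: "0 < b" and d: "0 < d"
    and gl: "\<And>u. 0 < u \<Longrightarrow> 2 * b * prob {\<omega>\<in>space P. b * u \<le> f \<omega> \<and> g \<omega> < d * u}
                \<le> prob {\<omega>\<in>space P. u \<le> f \<omega>}"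
  shows "(\<integral>\<^sup>+\<omega>. ennreal (f \<omega>) \<partial>P) \<le> ennreal (2 * b / d) * (\<integral>\<^sup>+\<omega>. ennreal (g \<omega>) \<partial>P)"
proof -
  let ?I = "\<lambda>h u. indicator {0<..} u * emeasure P {\<omega>\<in>space P. u \<le> h \<omega>} :: ennreal"
  have pw: "?I (\<lambda>\<omega>. f \<omega> / b) u \<le> ennreal (1 / (2 * b)) * ?I f u + ?I (\<lambda>\<omega>. g \<omega> / d) u" for u
  proof (cases "0 < u")
    case True
    have "prob {\<omega>\<in>space P. u \<le> f \<omega> / b} \<le>
        prob ({\<omega>\<in>space P. b * u \<le> f \<omega> \<and> g \<omega> < d * u} \<union> {\<omega>\<in>space P. u \<le> g \<omega> / d})"
      using B d by (intro finite_measure_mono) (auto simp: pos_le_divide_eq mult.commute, measurable)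
    also have "\<dots> \<le> prob {\<omega>\<in>space P. b * u \<le> f \<omega> \<and> g \<omega> < d * u} + prob {\<omega>\<in>space P. u \<le> g \<omega> / d}"
      by (intro measure_Un_le) measurable
    also have "\<dots> \<le> 1 / (2 * b) * prob {\<omega>\<in>space P. u \<le> f \<omega>} + prob {\<omega>\<in>space P. u \<le> g \<omega> / d}"
      using gl[OF True] B by (simp add: field_simps)
    finally have "ennreal (prob {\<omega>\<in>space P. u \<le> f \<omega> / b}) \<le>
      ennreal (1 / (2 * b) * prob {\<omega>\<in>space P. u \<le> f \<omega>} + prob {\<omega>\<in>space P. u \<le> g \<omega> / d})"
      by (rule ennreal_leI)
    also have "\<dots> = ennreal (1 / (2 * b)) * prob {\<omega>\<in>space P. u \<le> f \<omega>} + prob {\<omega>\<in>space P. u \<le> g \<omega> / d}"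
      using B by (subst ennreal_plus) (auto simp: ennreal_mult[symmetric])
    finally show ?thesis using True by (simp add: emeasure_eq_measure)
  qed simp
  \<comment> \<open>Boundedness by \<open>K\<close> makes both expectations finite, which justifies
    the subtraction; \<open>K\<close> does not enter the constant.\<close>
  have int: "integrable P f" "integrable P g"
    by (rule integrable_const_bound[where B = K]; use f g in auto)+
  have "(\<integral>\<^sup>+\<omega>. ennreal (f \<omega> / b) \<partial>P) = (\<integral>\<^sup>+u. ?I (\<lambda>\<omega>. f \<omega> / b) u \<partial>lborel)"
    using f B by (intro layer_cake) auto
  also have "\<dots> \<le> (\<integral>\<^sup>+u. ennreal (1 / (2 * b)) * ?I f u + ?I (\<lambda>\<omega>. g \<omega> / d) u \<partial>lborel)"
    by (intro nn_integral_mono pw)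
  also have "\<dots> = ennreal (1 / (2 * b)) * (\<integral>\<^sup>+u. ?I f u \<partial>lborel) + (\<integral>\<^sup>+u. ?I (\<lambda>\<omega>. g \<omega> / d) u \<partial>lborel)"
    by (subst nn_integral_add, measurable) (subst nn_integral_cmult, measurable)
  also have "\<dots> = ennreal (1 / (2 * b)) * (\<integral>\<^sup>+\<omega>. ennreal (f \<omega>) \<partial>P) + (\<integral>\<^sup>+\<omega>. ennreal (g \<omega> / d) \<partial>P)"
    using f g d by (subst (1 2) layer_cake) auto
  finally have le: "(\<integral>\<^sup>+\<omega>. ennreal (f \<omega> / b) \<partial>P) \<le>
    ennreal (1 / (2 * b)) * (\<integral>\<^sup>+\<omega>. ennreal (f \<omega>) \<partial>P) + (\<integral>\<^sup>+\<omega>. ennreal (g \<omega> / d) \<partial>P)" .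
  have nn: "(\<integral>\<^sup>+\<omega>. ennreal (h \<omega>) \<partial>P) = ennreal (integral\<^sup>L P h)"
    if "integrable P h" "\<And>\<omega>. \<omega> \<in> space P \<Longrightarrow> 0 \<le> h \<omega>" for h
    using that by (intro nn_integral_eq_integral) auto
  have pos: "0 \<le> integral\<^sup>L P f" "0 \<le> integral\<^sup>L P g" using f g by (auto intro!: integral_nonneg_AE)
  have "ennreal (integral\<^sup>L P f / b) \<le> ennreal (1 / (2 * b)) * ennreal (integral\<^sup>L P f) + ennreal (integral\<^sup>L P g / d)"
    using le int f g B d by (simp add: nn)
  also have "\<dots> = ennreal (integral\<^sup>L P f / (2 * b) + integral\<^sup>L P g / d)"
    using pos B d by (simp add: ennreal_mult[symmetric] ennreal_plus[symmetric] del: ennreal_plus)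
  finally have "integral\<^sup>L P f / b \<le> integral\<^sup>L P f / (2 * b) + integral\<^sup>L P g / d"
    using pos B d by (subst (asm) ennreal_le_iff) auto
  then have "integral\<^sup>L P f \<le> 2 * b / d * integral\<^sup>L P g" using B d by (simp add: field_simps)
  then show ?thesis using pos int f g B d
    by (simp add: nn ennreal_mult[symmetric] ennreal_leI)
qed

end

subsection \<open>Moment inequalities and series\<close>

lemma powr_le_powr_iff:
  fixes x y :: real
  assumes "0 \<le> x" "0 \<le> y" "0 < p"
  shows "x powr p \<le> y powr p \<longleftrightarrow> x \<le> y"
  using assms powr_mono2[of p x y] powr_less_mono2[of p y x] by (meson less_eq_real_def not_le)

context complete_filtered_space
begin

lemma increasing_process_powr:
  assumes V: "increasing_process V" and p: "0 < p"
  shows "increasing_process (\<lambda>t \<omega>. V t \<omega> powr p)"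
proof -
  have c: "continuous_process V" using V by (simp add: increasing_process_def)
  have "continuous_on {0..T} (\<lambda>t. V t \<omega> powr p)" if "\<omega> \<in> space P" for \<omega>
    using continuous_process_continuous[OF c that] increasing_process_nonneg[OF V that] p
    by (intro continuous_on_powr') (auto intro: continuous_intros)
  moreover have "(\<lambda>\<omega>. V t \<omega> powr p) \<in> borel_measurable (F t)" if "t \<in> {0..T}" for t
    using continuous_process_adapted[OF c that] by (rule powr_real_measurable) simp
  moreover have "V s \<omega> powr p \<le> V t \<omega> powr p"
    if "\<omega> \<in> space P" "s \<in> {0..T}" "t \<in> {0..T}" "s \<le> t" for \<omega> s t
    using that p increasing_process_nonneg[OF V that(1,2)] increasing_process_mono[OF V that(1), of s t] by (intro powr_mono2) auto
  ultimately show ?thesis using V p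
    by (auto simp: increasing_process_def continuous_process_def adapted_process_def monotone_on_def)
qed

lemma increasing_process_sum:
  assumes "\<And>n. increasing_process (f n)"
  shows "increasing_process (\<lambda>t \<omega>. \<Sum>n<N. f n t \<omega>)"
proof -
  have "continuous_process (\<lambda>t \<omega>. \<Sum>n<N. f n t \<omega>)" using assms by (intro continuous_process_sum) (auto simp: increasing_process_def)
  moreover have "(\<Sum>n<N. f n s \<omega>) \<le> (\<Sum>n<N. f n t \<omega>)"
    if "\<omega> \<in> space P" "s \<in> {0..T}" "t \<in> {0..T}" "s \<le> t" for \<omega> s t
    using that increasing_process_mono[OF assms that(1), of s t] by (intro sum_mono) auto
  moreover have "(\<Sum>n<N. f n 0 \<omega>) = 0" if "\<omega> \<in> space P" for \<omega>
    using assms that by (simp add: increasing_process_def)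
  ultimately show ?thesis by (auto simp: increasing_process_def monotone_on_def)
qed

text \<open>Good-lambda with ratio \<open>2\<close> is applied at the level \<open>l\<close> with
  \<open>l powr p = u\<close>. Doubling \<open>l\<close> multiplies \<open>u\<close> by
  \<open>2 powr p\<close>, so \<open>d\<close> is chosen to make the tail factor
  \<open>1 / (2 * 2 powr p)\<close>. Since \<open>l\<^sup>2\<close> to the power
  \<open>p / 2\<close> is \<open>u\<close>, the scale for \<open>A\<close> becomes
  \<open>d powr (p / 2)\<close>.\<close>

lemma moment_sup_le:
  assumes MA: "qv_pair M A" and \<theta>: "bounded_stopping_time \<theta>" and p: "0 < p"
    and bnd: "\<And>\<omega>. \<omega> \<in> space P \<Longrightarrow> \<forall>t\<in>{0..\<theta> \<omega>}. \<bar>M t \<omega>\<bar> \<le> C \<and> A t \<omega> \<le> C"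
  defines "d \<equiv> 1 / (2 * 2 powr p)"
  shows "(\<integral>\<^sup>+\<omega>. ennreal (running_sup M (\<theta> \<omega>) \<omega> powr p) \<partial>P)
    \<le> ennreal (2 * 2 powr p / d powr (p / 2)) * (\<integral>\<^sup>+\<omega>. ennreal (A (\<theta> \<omega>) \<omega> powr (p / 2)) \<partial>P)"
proof -
  have M: "continuous_process M" and A: "increasing_process A" "continuous_process A" and M0: "\<And>\<omega>. \<omega> \<in> space P \<Longrightarrow> M 0 \<omega> = 0"
    using MA by (auto simp: qv_pair_def increasing_process_def)
  have V: "increasing_process (running_sup M)" by (intro increasing_process_running_sup M M0)
  have dpos: "0 < d" by (simp add: d_def)
  note Vp = increasing_process_powr[OF V p]
  have p2: "0 < p / 2" using p by simp
  note Ap = increasing_process_powr[OF A(1) p2]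
  have V0: "0 \<le> running_sup M (\<theta> \<omega>) \<omega>" and A0: "0 \<le> A (\<theta> \<omega>) \<omega>" if "\<omega> \<in> space P" for \<omega>
    using increasing_process_nonneg[OF V that bounded_stopping_time_mem[OF \<theta> that]] increasing_process_nonneg[OF A(1) that bounded_stopping_time_mem[OF \<theta> that]] by auto
  have VC: "running_sup M (\<theta> \<omega>) \<omega> \<le> C" and AC: "A (\<theta> \<omega>) \<omega> \<le> C" if "\<omega> \<in> space P" for \<omega>
    using bnd[OF that] bounded_stopping_time_mem[OF \<theta> that] by (auto simp: running_sup_le_iff[OF M that])
  show ?thesis
  proof (rule good_lambda_moment[where K = "max (C powr p) (C powr (p / 2))"])
    show "(\<lambda>\<omega>. running_sup M (\<theta> \<omega>) \<omega> powr p) \<in> borel_measurable P"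
      "(\<lambda>\<omega>. A (\<theta> \<omega>) \<omega> powr (p / 2)) \<in> borel_measurable P"
      using bounded_stopping_time_borel_measurable[OF _ \<theta>] Vp Ap by (auto simp: increasing_process_def)
    show "running_sup M (\<theta> \<omega>) \<omega> powr p \<le> max (C powr p) (C powr (p / 2))" if "\<omega> \<in> space P" for \<omega>
      using V0[OF that] VC[OF that] p by (intro max.coboundedI1 powr_mono2) auto
    show "A (\<theta> \<omega>) \<omega> powr (p / 2) \<le> max (C powr p) (C powr (p / 2))" if "\<omega> \<in> space P" for \<omega>
      using A0[OF that] AC[OF that] p by (intro max.coboundedI2 powr_mono2) auto
    fix u :: real assume u: "0 < u"
    define l where "l = u powr (1 / p)"
    have l: "0 < l" "u = l powr p" using u p by (auto simp: l_def powr_powr)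
    have l2: "(l\<^sup>2) powr (p / 2) = l powr p" using l(1) by (simp flip: powr_numeral add: powr_powr)
    have e1: "2 powr p * u \<le> v powr p \<longleftrightarrow> 2 * l \<le> v" "u \<le> v powr p \<longleftrightarrow> l \<le> v" if "0 \<le> v" for v
      using that l(1) p powr_le_powr_iff[of "2 * l" v p] powr_le_powr_iff[of l v p]
      by (auto simp: l(2) powr_mult)
    have e2: "a powr (p / 2) < d powr (p / 2) * u \<longleftrightarrow> a < d * l\<^sup>2" if "0 \<le> a" for a
      using that l(1) p dpos powr_le_powr_iff[of "d * l\<^sup>2" a "p / 2"]
      by (simp add: powr_mult l2 l(2) not_le[symmetric])
    have E: "{\<omega>\<in>space P. 2 powr p * u \<le> running_sup M (\<theta> \<omega>) \<omega> powr p \<and> A (\<theta> \<omega>) \<omega> powr (p / 2) < d powr (p / 2) * u}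
      = {\<omega>\<in>space P. 2 * l \<le> running_sup M (\<theta> \<omega>) \<omega> \<and> A (\<theta> \<omega>) \<omega> < d * l\<^sup>2}"
      using e1(1)[OF V0] e2[OF A0] by auto
    have H: "{\<omega>\<in>space P. u \<le> running_sup M (\<theta> \<omega>) \<omega> powr p} = {\<omega>\<in>space P. l \<le> running_sup M (\<theta> \<omega>) \<omega>}"
      using e1(2)[OF V0] by auto
    show "2 * 2 powr p * prob {\<omega>\<in>space P. 2 powr p * u \<le> running_sup M (\<theta> \<omega>) \<omega> powr p \<and> A (\<theta> \<omega>) \<omega> powr (p / 2) < d powr (p / 2) * u}
      \<le> prob {\<omega>\<in>space P. u \<le> running_sup M (\<theta> \<omega>) \<omega> powr p}"
      unfolding E H using good_lambda_sup[OF MA \<theta> bnd l(1), of 2 d] dpos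
      by (simp add: d_def field_simps)
  qed (use dpos in auto)
qed

text \<open>The supremum of the absolute value is bounded by one of the suprema of \<open>M\<close>
  and \<open>-M\<close>, hence its power by the sum of theirs. This costs a factor
  \<open>2\<close>.\<close>

lemma moment_abs_sup_le:
  assumes MA: "qv_pair M A" and \<theta>: "bounded_stopping_time \<theta>" and p: "0 < p"
    and bnd: "\<And>\<omega>. \<omega> \<in> space P \<Longrightarrow> \<forall>t\<in>{0..\<theta> \<omega>}. \<bar>M t \<omega>\<bar> \<le> C \<and> A t \<omega> \<le> C"
  defines "d \<equiv> 1 / (2 * 2 powr p)"
  shows "(\<integral>\<^sup>+\<omega>. ennreal (running_sup (\<lambda>t \<omega>. \<bar>M t \<omega>\<bar>) (\<theta> \<omega>) \<omega> powr p) \<partial>P)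
    \<le> ennreal (2 * (2 * 2 powr p / d powr (p / 2))) * (\<integral>\<^sup>+\<omega>. ennreal (A (\<theta> \<omega>) \<omega> powr (p / 2)) \<partial>P)"
proof -
  let ?c = "2 * 2 powr p / d powr (p / 2)" and ?N = "\<lambda>t \<omega>. - M t \<omega>"
  note NA = qv_pair_uminus[OF MA]
  have M: "continuous_process M" and N: "continuous_process ?N" and M0: "\<And>\<omega>. \<omega> \<in> space P \<Longrightarrow> M 0 \<omega> = 0"
    using MA NA by (auto simp: qv_pair_def)
  have V: "increasing_process (running_sup M)" by (intro increasing_process_running_sup M M0)
  have V': "increasing_process (running_sup ?N)" by (intro increasing_process_running_sup N) (use M0 in auto)
  have absM: "continuous_process (\<lambda>t \<omega>. \<bar>M t \<omega>\<bar>)" by (intro continuous_process_compose[OF M] continuous_intros)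
  have "(\<integral>\<^sup>+\<omega>. ennreal (running_sup (\<lambda>t \<omega>. \<bar>M t \<omega>\<bar>) (\<theta> \<omega>) \<omega> powr p) \<partial>P)
    \<le> (\<integral>\<^sup>+\<omega>. ennreal (running_sup M (\<theta> \<omega>) \<omega> powr p) + ennreal (running_sup ?N (\<theta> \<omega>) \<omega> powr p) \<partial>P)"
  proof (rule nn_integral_mono)
    fix \<omega> assume \<omega>: "\<omega> \<in> space P"
    have \<theta>T: "\<theta> \<omega> \<in> {0..T}" by (rule bounded_stopping_time_mem[OF \<theta> \<omega>])
    obtain s where s: "s \<in> {0..\<theta> \<omega>}" "running_sup (\<lambda>t \<omega>. \<bar>M t \<omega>\<bar>) (\<theta> \<omega>) \<omega> = \<bar>M s \<omega>\<bar>"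
      using running_sup_attained[OF absM \<omega> \<theta>T] by metis
    have "\<bar>M s \<omega>\<bar> \<le> running_sup M (\<theta> \<omega>) \<omega> \<or> \<bar>M s \<omega>\<bar> \<le> running_sup ?N (\<theta> \<omega>) \<omega>"
      using running_sup_upper[OF M \<omega> \<theta>T s(1)] running_sup_upper[OF N \<omega> \<theta>T s(1)] by linarith
    then have "\<bar>M s \<omega>\<bar> powr p \<le> running_sup M (\<theta> \<omega>) \<omega> powr p \<or> \<bar>M s \<omega>\<bar> powr p \<le> running_sup ?N (\<theta> \<omega>) \<omega> powr p"
      using p by (auto intro: powr_mono2)
    then have "\<bar>M s \<omega>\<bar> powr p \<le> running_sup M (\<theta> \<omega>) \<omega> powr p + running_sup ?N (\<theta> \<omega>) \<omega> powr p"
      by (auto intro: add_increasing add_increasing2)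
    then show "ennreal (running_sup (\<lambda>t \<omega>. \<bar>M t \<omega>\<bar>) (\<theta> \<omega>) \<omega> powr p)
      \<le> ennreal (running_sup M (\<theta> \<omega>) \<omega> powr p) + ennreal (running_sup ?N (\<theta> \<omega>) \<omega> powr p)"
      unfolding s(2) by (simp add: ennreal_plus[symmetric] ennreal_leI del: ennreal_plus)
  qed
  also have "\<dots> = (\<integral>\<^sup>+\<omega>. ennreal (running_sup M (\<theta> \<omega>) \<omega> powr p) \<partial>P) + (\<integral>\<^sup>+\<omega>. ennreal (running_sup ?N (\<theta> \<omega>) \<omega> powr p) \<partial>P)"
    using bounded_stopping_time_borel_measurable[OF _ \<theta>] increasing_process_powr[OF V p] increasing_process_powr[OF V' p]
    by (intro nn_integral_add measurable_compose[OF _ measurable_ennreal]) (auto simp: increasing_process_def)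
  also have "\<dots> \<le> ennreal ?c * (\<integral>\<^sup>+\<omega>. ennreal (A (\<theta> \<omega>) \<omega> powr (p / 2)) \<partial>P)
      + ennreal ?c * (\<integral>\<^sup>+\<omega>. ennreal (A (\<theta> \<omega>) \<omega> powr (p / 2)) \<partial>P)"
    unfolding d_def using bnd by (intro add_mono moment_sup_le[OF MA \<theta> p] moment_sup_le[OF NA \<theta> p]) auto
  also have "\<dots> = ennreal (2 * ?c) * (\<integral>\<^sup>+\<omega>. ennreal (A (\<theta> \<omega>) \<omega> powr (p / 2)) \<partial>P)"
    by (simp only: distrib_right[symmetric] mult_2) (subst ennreal_plus, auto)
  finally show ?thesis .
qed

text \<open>The scaling is again \<open>u = l powr p\<close>. Doubling the level
  \<open>l\<^sup>2\<close> of \<open>A\<close> multiplies \<open>u\<close> by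
  \<open>b = 2 powr (p / 2)\<close>, and \<open>d\<close> is the root of \<open>1 / (2 * b)\<close>
  because the good-lambda bound carries \<open>d\<^sup>2\<close>.\<close>

lemma moment_qv_le:
  assumes MA: "qv_pair M A" and \<theta>: "bounded_stopping_time \<theta>" and p: "0 < p"
    and bnd: "\<And>\<omega>. \<omega> \<in> space P \<Longrightarrow> \<forall>t\<in>{0..\<theta> \<omega>}. \<bar>M t \<omega>\<bar> \<le> C \<and> A t \<omega> \<le> C"
  defines "b \<equiv> 2 powr (p / 2)"
  defines "d \<equiv> sqrt (1 / (2 * b))"
  shows "(\<integral>\<^sup>+\<omega>. ennreal (A (\<theta> \<omega>) \<omega> powr (p / 2)) \<partial>P) \<le>
    ennreal (2 * b / d powr p) * (\<integral>\<^sup>+\<omega>. ennreal (running_sup (\<lambda>t \<omega>. \<bar>M t \<omega>\<bar>) (\<theta> \<omega>) \<omega> powr p) \<partial>P)"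
proof -
  define W where "W = running_sup (\<lambda>t \<omega>. \<bar>M t \<omega>\<bar>)"
  have M: "continuous_process M" and A: "increasing_process A" "continuous_process A" and M0: "\<And>\<omega>. \<omega> \<in> space P \<Longrightarrow> M 0 \<omega> = 0"
    using MA by (auto simp: qv_pair_def increasing_process_def)
  have absM: "continuous_process (\<lambda>t \<omega>. \<bar>M t \<omega>\<bar>)" by (intro continuous_process_compose[OF M] continuous_intros)
  have W: "increasing_process W" unfolding W_def by (intro increasing_process_running_sup absM) (use M0 in auto)
  have bpos: "0 < b" by (simp add: b_def)
  then have dpos: "0 < d" by (simp add: d_def)
  note Wp = increasing_process_powr[OF W p]
  have p2: "0 < p / 2" using p by simp
  note Ap = increasing_process_powr[OF A(1) p2]
  have W0: "0 \<le> W (\<theta> \<omega>) \<omega>" and A0: "0 \<le> A (\<theta> \<omega>) \<omega>" if "\<omega> \<in> space P" for \<omega>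
    using increasing_process_nonneg[OF W that bounded_stopping_time_mem[OF \<theta> that]] increasing_process_nonneg[OF A(1) that bounded_stopping_time_mem[OF \<theta> that]] by auto
  have WC: "W (\<theta> \<omega>) \<omega> \<le> C" and AC: "A (\<theta> \<omega>) \<omega> \<le> C" if "\<omega> \<in> space P" for \<omega>
    using bnd[OF that] bounded_stopping_time_mem[OF \<theta> that] unfolding W_def by (auto simp: running_sup_le_iff[OF absM that])
  show ?thesis unfolding W_def[symmetric]
  proof (rule good_lambda_moment[where K = "max (C powr p) (C powr (p / 2))"])
    show "(\<lambda>\<omega>. W (\<theta> \<omega>) \<omega> powr p) \<in> borel_measurable P"
      "(\<lambda>\<omega>. A (\<theta> \<omega>) \<omega> powr (p / 2)) \<in> borel_measurable P"
      using bounded_stopping_time_borel_measurable[OF _ \<theta>] Wp Ap by (auto simp: increasing_process_def)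
    show "W (\<theta> \<omega>) \<omega> powr p \<le> max (C powr p) (C powr (p / 2))" if "\<omega> \<in> space P" for \<omega>
      using W0[OF that] WC[OF that] p by (intro max.coboundedI1 powr_mono2) auto
    show "A (\<theta> \<omega>) \<omega> powr (p / 2) \<le> max (C powr p) (C powr (p / 2))" if "\<omega> \<in> space P" for \<omega>
      using A0[OF that] AC[OF that] p by (intro max.coboundedI2 powr_mono2) auto
    fix u :: real assume u: "0 < u"
    define l where "l = u powr (1 / p)"
    have l: "0 < l" "u = l powr p" using u p by (auto simp: l_def powr_powr)
    have l2: "(l\<^sup>2) powr (p / 2) = l powr p" using l(1) by (simp flip: powr_numeral add: powr_powr)
    have e1: "b * u \<le> a powr (p / 2) \<longleftrightarrow> 2 * l\<^sup>2 \<le> a" "u \<le> a powr (p / 2) \<longleftrightarrow> l\<^sup>2 \<le> a" if "0 \<le> a" for a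
      using that l(1) p powr_le_powr_iff[of "2 * l\<^sup>2" a "p / 2"] powr_le_powr_iff[of "l\<^sup>2" a "p / 2"]
      by (auto simp: l(2) l2 powr_mult b_def)
    have e2: "v powr p < d powr p * u \<longleftrightarrow> v < d * l" if "0 \<le> v" for v
      using that l(1) p dpos powr_le_powr_iff[of "d * l" v p]
      by (simp add: powr_mult l(2) not_le[symmetric])
    have E: "{\<omega>\<in>space P. b * u \<le> A (\<theta> \<omega>) \<omega> powr (p / 2) \<and> W (\<theta> \<omega>) \<omega> powr p < d powr p * u}
      = {\<omega>\<in>space P. 2 * l\<^sup>2 \<le> A (\<theta> \<omega>) \<omega> \<and> W (\<theta> \<omega>) \<omega> < d * l}"
      using e1(1)[OF A0] e2[OF W0] by auto
    have H: "{\<omega>\<in>space P. u \<le> A (\<theta> \<omega>) \<omega> powr (p / 2)} = {\<omega>\<in>space P. l\<^sup>2 \<le> A (\<theta> \<omega>) \<omega>}"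
      using e1(2)[OF A0] by auto
    have d2: "d\<^sup>2 = 1 / (2 * b)" using bpos by (simp add: d_def)
    show "2 * b * prob {\<omega>\<in>space P. b * u \<le> A (\<theta> \<omega>) \<omega> powr (p / 2) \<and> W (\<theta> \<omega>) \<omega> powr p < d powr p * u}
      \<le> prob {\<omega>\<in>space P. u \<le> A (\<theta> \<omega>) \<omega> powr (p / 2)}"
      unfolding E H using good_lambda_qv[OF MA \<theta> bnd l(1), of 2 d] dpos bpos
      unfolding W_def[symmetric] d2 by (simp add: field_simps)
  qed (use dpos bpos in auto)
qed

section \<open>Transfer of convergence from one series to the other\<close>

text \<open>Each \<open>N\<close> has its own stopping time, but the bound \<open>C * K\<close> for
  the stopped partial sum of \<open>f\<close> is uniform in \<open>N\<close>. On \<open>E K\<close>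
  the partial sums of \<open>g\<close> never reach \<open>K\<close>, so the bound passes to the
  whole series there; the events \<open>E K\<close> exhaust almost every path on which the series of
  \<open>g\<close> converges.\<close>

lemma summable_transfer:
  assumes f: "\<And>n. increasing_process (f n)" and g: "\<And>n. increasing_process (g n)" and C: "0 \<le> C"
    and dom: "\<And>n \<theta> K. bounded_stopping_time \<theta> \<Longrightarrow>
      (\<And>\<omega> t. \<omega> \<in> space P \<Longrightarrow> t \<in> {0..\<theta> \<omega>} \<Longrightarrow> f n t \<omega> \<le> K \<and> g n t \<omega> \<le> K) \<Longrightarrow>
      (\<integral>\<^sup>+\<omega>. ennreal (f n (\<theta> \<omega>) \<omega>) \<partial>P) \<le> ennreal C * (\<integral>\<^sup>+\<omega>. ennreal (g n (\<theta> \<omega>) \<omega>) \<partial>P)"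
    and sg: "AE \<omega> in P. summable (\<lambda>n. g n T \<omega>)"
  shows "AE \<omega> in P. summable (\<lambda>n. f n T \<omega>)"
proof -
  define SF where "SF = (\<lambda>N t \<omega>. \<Sum>n<N. f n t \<omega>)"
  define SG where "SG = (\<lambda>N t \<omega>. \<Sum>n<N. g n t \<omega>)"
  have SF: "increasing_process (SF N)" and SG: "increasing_process (SG N)" for N
    unfolding SF_def SG_def by (intro increasing_process_sum f g)+
  have T: "T \<in> {0..T}" using T_nonneg by simp
  have cf: "continuous_process (f n)" and cg: "continuous_process (g n)" for n using f g by (auto simp: increasing_process_def)
  have fT[measurable]: "f n T \<in> borel_measurable P" and gT[measurable]: "g n T \<in> borel_measurable P" for n
    using measurable_F_P[OF order_refl continuous_process_adapted[OF cf T]] measurable_F_P[OF order_refl continuous_process_adapted[OF cg T]] by auto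
  have f0: "0 \<le> f n t \<omega>" and g0: "0 \<le> g n t \<omega>" if "\<omega> \<in> space P" "t \<in> {0..T}" for n t \<omega>
    using increasing_process_nonneg[OF f that] increasing_process_nonneg[OF g that] by auto
  define E where "E K = {\<omega>\<in>space P. \<forall>N. SG N T \<omega> < K}" for K :: real
  have [measurable]: "SF N T \<in> borel_measurable P" "SG N T \<in> borel_measurable P" for N
    unfolding SF_def SG_def by measurable
  have [measurable]: "E K \<in> sets P" for K unfolding E_def by measurable
  \<comment> \<open>The second level \<open>b\<close> serves to make the processes bounded up to
    \<open>\<theta>\<close>, as \<open>dom\<close> demands. It is absent from the estimate and can
    be sent to infinity.\<close>
  have stopped: "(\<integral>\<^sup>+\<omega>. ennreal (SF N T \<omega>) * indicator (E K \<inter> {\<omega>\<in>space P. SF N T \<omega> < b}) \<omega> \<partial>P) \<le> ennreal (C * K)"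
    if "0 < K" "0 < b" for N K b
  proof -
    define \<theta> where "\<theta> = (\<lambda>\<omega>. min (hitting_time (SG N) K \<omega>) (hitting_time (SF N) b \<omega>))"
    have \<theta>: "bounded_stopping_time \<theta>" unfolding \<theta>_def by (intro bounded_stopping_time_min bounded_stopping_time_hit SF SG)
    have \<theta>T: "\<theta> \<omega> = T" if "\<omega> \<in> E K \<inter> {\<omega>\<in>space P. SF N T \<omega> < b}" for \<omega>
    proof -
      have "T \<le> \<theta> \<omega>" using that T unfolding \<theta>_def E_def
        by (auto intro!: le_hitting_time SF SG)
      then show ?thesis using bounded_stopping_time_mem[OF \<theta>, of \<omega>] that by auto
    qed
    have bd: "SF N t \<omega> \<le> b" "SG N t \<omega> \<le> K" if "\<omega> \<in> space P" "t \<in> {0..\<theta> \<omega>}" for \<omega> t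
      using that by (auto simp: \<theta>_def intro!: before_hitting_time[OF SF] before_hitting_time[OF SG] \<open>0 < K\<close> \<open>0 < b\<close>)
    have bd': "f n t \<omega> \<le> max b K \<and> g n t \<omega> \<le> max b K"
      if "n < N" "\<omega> \<in> space P" "t \<in> {0..\<theta> \<omega>}" for n \<omega> t
    proof -
      have t: "t \<in> {0..T}" using that(3) bounded_stopping_time_mem[OF \<theta> that(2)] by auto
      have "f n t \<omega> \<le> SF N t \<omega>" "g n t \<omega> \<le> SG N t \<omega>" unfolding SF_def SG_def
        using that(1) f0[OF that(2) t] g0[OF that(2) t] by (auto intro!: member_le_sum)
      then show ?thesis using bd[OF that(2,3)] by auto
    qed
    have [measurable]: "(\<lambda>\<omega>. f n (\<theta> \<omega>) \<omega>) \<in> borel_measurable P" "(\<lambda>\<omega>. g n (\<theta> \<omega>) \<omega>) \<in> borel_measurable P" for n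
      by (intro bounded_stopping_time_borel_measurable cf cg \<theta>)+
    have "(\<integral>\<^sup>+\<omega>. ennreal (SF N T \<omega>) * indicator (E K \<inter> {\<omega>\<in>space P. SF N T \<omega> < b}) \<omega> \<partial>P)
      \<le> (\<integral>\<^sup>+\<omega>. ennreal (SF N (\<theta> \<omega>) \<omega>) \<partial>P)"
      using \<theta>T by (intro nn_integral_mono) (auto simp: indicator_def)
    also have "\<dots> = (\<integral>\<^sup>+\<omega>. (\<Sum>n<N. ennreal (f n (\<theta> \<omega>) \<omega>)) \<partial>P)"
      unfolding SF_def using f0 bounded_stopping_time_mem[OF \<theta>]
      by (intro nn_integral_cong) (auto intro!: sum_ennreal[symmetric])
    also have "\<dots> = (\<Sum>n<N. \<integral>\<^sup>+\<omega>. ennreal (f n (\<theta> \<omega>) \<omega>) \<partial>P)" by (rule nn_integral_sum) measurable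
    also have "\<dots> \<le> (\<Sum>n<N. ennreal C * (\<integral>\<^sup>+\<omega>. ennreal (g n (\<theta> \<omega>) \<omega>) \<partial>P))"
    proof (rule sum_mono)
      fix n assume n: "n \<in> {..<N}"
      show "(\<integral>\<^sup>+\<omega>. ennreal (f n (\<theta> \<omega>) \<omega>) \<partial>P) \<le> ennreal C * (\<integral>\<^sup>+\<omega>. ennreal (g n (\<theta> \<omega>) \<omega>) \<partial>P)"
        by (rule dom[OF \<theta> bd']) (use n in auto)
    qed
    also have "\<dots> = ennreal C * (\<Sum>n<N. \<integral>\<^sup>+\<omega>. ennreal (g n (\<theta> \<omega>) \<omega>) \<partial>P)" by (simp add: sum_distrib_left)
    also have "\<dots> = ennreal C * (\<integral>\<^sup>+\<omega>. (\<Sum>n<N. ennreal (g n (\<theta> \<omega>) \<omega>)) \<partial>P)"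
      by (subst nn_integral_sum) auto
    also have "(\<integral>\<^sup>+\<omega>. (\<Sum>n<N. ennreal (g n (\<theta> \<omega>) \<omega>)) \<partial>P) = (\<integral>\<^sup>+\<omega>. ennreal (SG N (\<theta> \<omega>) \<omega>) \<partial>P)"
      unfolding SG_def using g0 bounded_stopping_time_mem[OF \<theta>]
      by (intro nn_integral_cong) (auto intro!: sum_ennreal)
    also have "\<dots> \<le> (\<integral>\<^sup>+\<omega>. ennreal K \<partial>P)"
      using bd(2) bounded_stopping_time_mem[OF \<theta>] by (intro nn_integral_mono ennreal_leI) auto
    also have "\<dots> = ennreal K" by (simp add: emeasure_space_1)
    finally show ?thesis using C \<open>0 < K\<close> by (simp add: ennreal_mult mult_left_mono)
  qed
  have partial: "(\<integral>\<^sup>+\<omega>. ennreal (SF N T \<omega>) * indicator (E K) \<omega> \<partial>P) \<le> ennreal (C * K)" if K: "0 < K" for N K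
  proof -
    \<comment> \<open>Monotone convergence removes the truncation; the levels \<open>Suc b\<close>
      are positive, as \<open>stopped\<close> requires.\<close>
    let ?h = "\<lambda>b \<omega>. ennreal (SF N T \<omega>) * indicator (E K \<inter> {\<omega>\<in>space P. SF N T \<omega> < real (Suc b)}) \<omega>"
    have "(\<integral>\<^sup>+\<omega>. ennreal (SF N T \<omega>) * indicator (E K) \<omega> \<partial>P) \<le> (\<integral>\<^sup>+\<omega>. (SUP b. ?h b \<omega>) \<partial>P)"
    proof (rule nn_integral_mono)
      fix \<omega> assume \<omega>: "\<omega> \<in> space P"
      obtain b where "SF N T \<omega> < real b" using reals_Archimedean2 by blast
      then have "ennreal (SF N T \<omega>) * indicator (E K) \<omega> \<le> ?h b \<omega>" using \<omega> by (auto simp: indicator_def)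
      also have "\<dots> \<le> (SUP b. ?h b \<omega>)" by (rule SUP_upper) simp
      finally show "ennreal (SF N T \<omega>) * indicator (E K) \<omega> \<le> (SUP b. ?h b \<omega>)" .
    qed
    also have "\<dots> = (SUP b. integral\<^sup>N P (?h b))"
    proof (rule nn_integral_monotone_convergence_SUP)
      show "incseq ?h" by (auto simp: incseq_def le_fun_def indicator_def)
    qed measurable
    also have "\<dots> \<le> ennreal (C * K)" using K by (intro SUP_least stopped) auto
    finally show ?thesis .
  qed
  have "AE \<omega> in P. \<omega> \<in> E K \<longrightarrow> summable (\<lambda>n. f n T \<omega>)" if K: "0 < K" for K
  proof -
    have "(\<integral>\<^sup>+\<omega>. (\<Sum>n. ennreal (f n T \<omega>) * indicator (E K) \<omega>) \<partial>P)
        = (\<Sum>n. \<integral>\<^sup>+\<omega>. ennreal (f n T \<omega>) * indicator (E K) \<omega> \<partial>P)"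
      by (rule nn_integral_suminf) measurable
    also have "\<dots> = (SUP N. \<Sum>n<N. \<integral>\<^sup>+\<omega>. ennreal (f n T \<omega>) * indicator (E K) \<omega> \<partial>P)"
      by (rule suminf_eq_SUP)
    also have "\<dots> \<le> ennreal (C * K)"
    proof (rule SUP_least)
      fix N
      have "(\<Sum>n<N. \<integral>\<^sup>+\<omega>. ennreal (f n T \<omega>) * indicator (E K) \<omega> \<partial>P) =
          (\<integral>\<^sup>+\<omega>. (\<Sum>n<N. ennreal (f n T \<omega>) * indicator (E K) \<omega>) \<partial>P)"
        by (rule nn_integral_sum[symmetric]) measurable
      also have "\<dots> = (\<integral>\<^sup>+\<omega>. ennreal (SF N T \<omega>) * indicator (E K) \<omega> \<partial>P)"
        unfolding SF_def using f0 T
        by (intro nn_integral_cong) (auto simp: sum_distrib_right[symmetric] intro!: arg_cong2[where f = "(*)"] sum_ennreal)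
      also have "\<dots> \<le> ennreal (C * K)" by (rule partial[OF K])
      finally show "(\<Sum>n<N. \<integral>\<^sup>+\<omega>. ennreal (f n T \<omega>) * indicator (E K) \<omega> \<partial>P) \<le> ennreal (C * K)" .
    qed
    \<comment> \<open>Finite expectation of the full series on \<open>E K\<close> makes the series
      finite almost everywhere on that event.\<close>
    finally have "(\<integral>\<^sup>+\<omega>. (\<Sum>n. ennreal (f n T \<omega>) * indicator (E K) \<omega>) \<partial>P) \<noteq> \<infinity>"
      by (auto simp: top_unique)
    then have "AE \<omega> in P. (\<Sum>n. ennreal (f n T \<omega>) * indicator (E K) \<omega>) \<noteq> \<infinity>"
      by (intro nn_integral_PInf_AE) measurable
    then show ?thesis using AE_space
    proof eventually_elim
      case (elim \<omega>)
      then show ?case using f0[OF elim(2) T] by (auto intro!: summable_suminf_not_top)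
    qed
  qed
  \<comment> \<open>Positive integer levels suffice, so that only countably many null sets are
    combined.\<close>
  then have "AE \<omega> in P. \<forall>k. \<omega> \<in> E (real (Suc k)) \<longrightarrow> summable (\<lambda>n. f n T \<omega>)"
    unfolding AE_all_countable by simp
  then show ?thesis using sg AE_space
  proof eventually_elim
    case (elim \<omega>)
    obtain k where k: "(\<Sum>n. g n T \<omega>) < real k" using reals_Archimedean2 by blast
    have "SG N T \<omega> \<le> (\<Sum>n. g n T \<omega>)" for N
      unfolding SG_def using elim g0[OF elim(3) T] by (intro sum_le_suminf) auto
    then have "SG N T \<omega> < real (Suc k)" for N
      using k by (rule le_less_trans[OF _ less_trans]) simp
    then have "\<omega> \<in> E (real (Suc k))" using elim(3) by (simp add: E_def)
    then show ?case using elim(1) by auto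
  qed
qed

section \<open>Regular versions and the equivalence for them\<close>

lemma continuous_process_version:
  assumes X: "adapted_process F T X" and N: "N \<in> null_sets P"
    and cont: "\<And>\<omega>. \<omega> \<in> space P - N \<Longrightarrow> continuous_on {0..T} (\<lambda>t. X t \<omega>)"
  shows "continuous_process (\<lambda>t \<omega>. if \<omega> \<in> N then 0 else X t \<omega>)"
  unfolding continuous_process_def adapted_process_def
proof (intro conjI ballI)
  show "(\<lambda>\<omega>. if \<omega> \<in> N then 0 else X t \<omega>) \<in> borel_measurable (F t)" if "t \<in> {0..T}" for t
    using X that null_sets_F[OF N, of t]
    by (intro measurable_If_set) (auto simp: adapted_process_def intro: sets.Int)
  show "continuous_on {0..T} (\<lambda>t. if \<omega> \<in> N then 0 else X t \<omega>)" if "\<omega> \<in> space P" for \<omega>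
    using cont[of \<omega>] that by (cases "\<omega> \<in> N") auto
qed

text \<open>One null set \<open>N\<close> collects all path defects of \<open>M\<close> and
  \<open>A\<close>, and both processes are set to \<open>0\<close> on it. The two identities of
  \<open>qv_pair\<close> are optional stopping for \<open>M\<close> and for
  \<open>M\<^sup>2 - A\<close>; under a common bound \<open>C\<close> the latter process is bounded
  by \<open>C\<^sup>2 + C\<close>.\<close>

lemma qv_pair_version:
  assumes M: "continuous_local_martingale P F T M" and M0: "AE \<omega> in P. M 0 \<omega> = 0"
    and A: "is_quadratic_variation P F T M A"
  obtains M' A' where "qv_pair M' A'"
    "AE \<omega> in P. \<forall>t\<in>{0..T}. M t \<omega> = M' t \<omega> \<and> A t \<omega> = A' t \<omega>"
proof -
  have ad: "adapted_process F T M" "adapted_process F T A"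
    using M A by (auto simp: continuous_local_martingale_def is_quadratic_variation_def)
  have "AE \<omega> in P. continuous_on {0..T} (\<lambda>t. M t \<omega>) \<and> M 0 \<omega> = 0 \<and> A 0 \<omega> = 0 \<and>
      continuous_on {0..T} (\<lambda>t. A t \<omega>) \<and> mono_on {0..T} (\<lambda>t. A t \<omega>)"
    using M M0 A by (auto simp: continuous_local_martingale_def is_quadratic_variation_def)
  then obtain N where N: "N \<in> null_sets P" and good: "\<And>\<omega>. \<omega> \<in> space P - N \<Longrightarrow>
      continuous_on {0..T} (\<lambda>t. M t \<omega>) \<and> M 0 \<omega> = 0 \<and> A 0 \<omega> = 0 \<and>
      continuous_on {0..T} (\<lambda>t. A t \<omega>) \<and> mono_on {0..T} (\<lambda>t. A t \<omega>)"
    by (rule AE_E3) blast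
  define M' where "M' = (\<lambda>t \<omega>. if \<omega> \<in> N then 0 else M t \<omega>)"
  define A' where "A' = (\<lambda>t \<omega>. if \<omega> \<in> N then 0 else A t \<omega>)"
  have cM: "continuous_process M'" and cA: "continuous_process A'"
    unfolding M'_def A'_def using good by (intro continuous_process_version ad N; blast)+
  have M'0: "M' 0 \<omega> = 0" if "\<omega> \<in> space P" for \<omega> using good[of \<omega>] that by (auto simp: M'_def)
  have iA: "increasing_process A'" using cA good by (auto simp: increasing_process_def A'_def monotone_on_def)
  have "AE \<omega> in P. \<omega> \<notin> N" using N by (rule AE_not_in)
  then have eq: "AE \<omega> in P. \<forall>t\<in>{0..T}. M t \<omega> = M' t \<omega> \<and> A t \<omega> = A' t \<omega>"
    by eventually_elim (auto simp: M'_def A'_def)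
  have "(\<integral>\<omega>. M' (\<rho> \<omega>) \<omega> \<partial>P) = 0 \<and> (\<integral>\<omega>. (M' (\<rho> \<omega>) \<omega>)\<^sup>2 - A' (\<rho> \<omega>) \<omega> \<partial>P) = 0"
    if \<rho>: "bounded_stopping_time \<rho>" and bnd: "\<forall>\<omega>\<in>space P. \<forall>t\<in>{0..\<rho> \<omega>}. \<bar>M' t \<omega>\<bar> \<le> C \<and> A' t \<omega> \<le> C" for \<rho> C
  proof
    show "(\<integral>\<omega>. M' (\<rho> \<omega>) \<omega> \<partial>P) = 0"
    proof (rule optional_stopping[OF M cM _ M'0 \<rho>, where C = C])
      show "AE \<omega> in P. \<forall>t\<in>{0..T}. M t \<omega> = M' t \<omega>" using eq by eventually_elim auto
    qed (use bnd in auto)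
    have clm: "continuous_local_martingale P F T (\<lambda>t \<omega>. (M t \<omega>)\<^sup>2 - A t \<omega>)"
      using A by (simp add: is_quadratic_variation_def)
    have c: "continuous_process (\<lambda>t \<omega>. (M' t \<omega>)\<^sup>2 - A' t \<omega>)"
      by (intro continuous_process_diff cA continuous_process_compose[OF cM] continuous_intros)
    show "(\<integral>\<omega>. (M' (\<rho> \<omega>) \<omega>)\<^sup>2 - A' (\<rho> \<omega>) \<omega> \<partial>P) = 0"
    proof (rule optional_stopping[OF clm c _ _ \<rho>])
      show "AE \<omega> in P. \<forall>t\<in>{0..T}. (M t \<omega>)\<^sup>2 - A t \<omega> = (M' t \<omega>)\<^sup>2 - A' t \<omega>"
        using eq by eventually_elim auto
      show "(M' 0 \<omega>)\<^sup>2 - A' 0 \<omega> = 0" if "\<omega> \<in> space P" for \<omega>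
        using M'0[OF that] iA that by (simp add: increasing_process_def)
      show "\<bar>(M' t \<omega>)\<^sup>2 - A' t \<omega>\<bar> \<le> C\<^sup>2 + C" if \<omega>: "\<omega> \<in> space P" and t: "t \<in> {0..\<rho> \<omega>}" for \<omega> t
      proof -
        have b: "\<bar>M' t \<omega>\<bar> \<le> C" "A' t \<omega> \<le> C" using bnd \<omega> t by auto
        have "0 \<le> A' t \<omega>" using t bounded_stopping_time_mem[OF \<rho> \<omega>] by (intro increasing_process_nonneg[OF iA \<omega>]) auto
        moreover have "(M' t \<omega>)\<^sup>2 \<le> C\<^sup>2" using power_mono[OF b(1), of 2] by simp
        ultimately show ?thesis using b(2) zero_le_power2[of "M' t \<omega>"] by linarith
      qed
    qed
  qed
  then have "qv_pair M' A'" using cM iA M'0 by (auto simp: qv_pair_def)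
  then show ?thesis using eq that by blast
qed

lemma qv_pair_summable_iff:
  assumes MA: "\<And>n. qv_pair (M n) (A n)" and p: "0 < p"
  shows "(AE \<omega> in P. summable (\<lambda>n. A n T \<omega> powr (p / 2))) \<longleftrightarrow>
    (AE \<omega> in P. summable (\<lambda>n. running_sup (\<lambda>t \<omega>. \<bar>M n t \<omega>\<bar>) T \<omega> powr p))"
proof -
  let ?W = "\<lambda>n. running_sup (\<lambda>t \<omega>. \<bar>M n t \<omega>\<bar>)"
  let ?a = "\<lambda>n t \<omega>. A n t \<omega> powr (p / 2)" and ?w = "\<lambda>n t \<omega>. ?W n t \<omega> powr p"
  have M: "continuous_process (M n)" and A: "increasing_process (A n)" and M0: "\<And>\<omega>. \<omega> \<in> space P \<Longrightarrow> M n 0 \<omega> = 0" for n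
    using MA by (auto simp: qv_pair_def)
  have absM: "continuous_process (\<lambda>t \<omega>. \<bar>M n t \<omega>\<bar>)" for n by (intro continuous_process_compose[OF M] continuous_intros)
  have W: "increasing_process (?W n)" for n by (intro increasing_process_running_sup absM) (use M0 in auto)
  have a: "increasing_process (?a n)" and w: "increasing_process (?w n)" for n
    using increasing_process_powr[OF A, of "p / 2"] increasing_process_powr[OF W p] p by auto
  \<comment> \<open>The transfer lemma bounds the powers by \<open>K\<close>, whereas the moment
    inequalities need one bound for \<open>M\<close> and \<open>A\<close> themselves. Inverting the
    exponents \<open>p\<close> and \<open>p / 2\<close> gives the two candidates.\<close>
  have bnd: "\<forall>t\<in>{0..\<theta> \<omega>}. \<bar>M n t \<omega>\<bar> \<le> max (K powr (2 / p)) (K powr (1 / p))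
      \<and> A n t \<omega> \<le> max (K powr (2 / p)) (K powr (1 / p))"
    if \<theta>: "bounded_stopping_time \<theta>" and \<omega>: "\<omega> \<in> space P"
      and K: "\<And>\<omega> t. \<omega> \<in> space P \<Longrightarrow> t \<in> {0..\<theta> \<omega>} \<Longrightarrow> ?a n t \<omega> \<le> K \<and> ?w n t \<omega> \<le> K" for n \<theta> K \<omega>
  proof
    fix t assume t: "t \<in> {0..\<theta> \<omega>}"
    have tT: "t \<in> {0..T}" using t bounded_stopping_time_mem[OF \<theta> \<omega>] by auto
    have "\<bar>M n t \<omega>\<bar> \<le> ?W n t \<omega>" using tT by (intro running_sup_upper[OF absM \<omega> tT]) auto
    also have "\<dots> = ?w n t \<omega> powr (1 / p)" using increasing_process_nonneg[OF W \<omega> tT] p by (simp add: powr_powr)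
    also have "\<dots> \<le> K powr (1 / p)" using K[OF \<omega> t] p by (intro powr_mono2) auto
    finally have 1: "\<bar>M n t \<omega>\<bar> \<le> K powr (1 / p)" .
    have "A n t \<omega> = ?a n t \<omega> powr (2 / p)" using increasing_process_nonneg[OF A \<omega> tT] p by (simp add: powr_powr)
    also have "\<dots> \<le> K powr (2 / p)" using K[OF \<omega> t] p by (intro powr_mono2) auto
    finally show "\<bar>M n t \<omega>\<bar> \<le> max (K powr (2 / p)) (K powr (1 / p))
      \<and> A n t \<omega> \<le> max (K powr (2 / p)) (K powr (1 / p))" using 1 by auto
  qed
  show ?thesis
  proof
    assume s: "AE \<omega> in P. summable (\<lambda>n. ?a n T \<omega>)"
    show "AE \<omega> in P. summable (\<lambda>n. ?w n T \<omega>)"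
    proof (rule summable_transfer[OF w a _ _ s])
      fix n \<theta> K
      assume \<theta>: "bounded_stopping_time \<theta>"
        and K: "\<And>\<omega> t. \<omega> \<in> space P \<Longrightarrow> t \<in> {0..\<theta> \<omega>} \<Longrightarrow> ?w n t \<omega> \<le> K \<and> ?a n t \<omega> \<le> K"
      show "(\<integral>\<^sup>+\<omega>. ennreal (?w n (\<theta> \<omega>) \<omega>) \<partial>P)
        \<le> ennreal (2 * (2 * 2 powr p / (1 / (2 * 2 powr p)) powr (p / 2))) * (\<integral>\<^sup>+\<omega>. ennreal (?a n (\<theta> \<omega>) \<omega>) \<partial>P)"
        by (rule moment_abs_sup_le[OF MA \<theta> p], rule bnd[OF \<theta>]) (use K in auto)
    qed simp
  next
    assume s: "AE \<omega> in P. summable (\<lambda>n. ?w n T \<omega>)"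
    show "AE \<omega> in P. summable (\<lambda>n. ?a n T \<omega>)"
    proof (rule summable_transfer[OF a w _ _ s])
      fix n \<theta> K
      assume \<theta>: "bounded_stopping_time \<theta>"
        and K: "\<And>\<omega> t. \<omega> \<in> space P \<Longrightarrow> t \<in> {0..\<theta> \<omega>} \<Longrightarrow> ?a n t \<omega> \<le> K \<and> ?w n t \<omega> \<le> K"
      show "(\<integral>\<^sup>+\<omega>. ennreal (?a n (\<theta> \<omega>) \<omega>) \<partial>P)
        \<le> ennreal (2 * 2 powr (p / 2) / sqrt (1 / (2 * 2 powr (p / 2))) powr p) * (\<integral>\<^sup>+\<omega>. ennreal (?w n (\<theta> \<omega>) \<omega>) \<partial>P)"
        by (rule moment_qv_le[OF MA \<theta> p], rule bnd[OF \<theta>]) (use K in auto)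
    qed simp
  qed
qed

text \<open>Raising to a positive power preserves order, so both suprema are attained at the same
  time \<open>s\<close>.\<close>

lemma SUP_powr_eq_running_sup:
  assumes X: "continuous_process X" and \<omega>: "\<omega> \<in> space P" and p: "0 < p"
    and eq: "\<forall>t\<in>{0..T}. Y t \<omega> = X t \<omega>"
  shows "(SUP t\<in>{0..T}. \<bar>Y t \<omega>\<bar> powr p) = running_sup (\<lambda>t \<omega>. \<bar>X t \<omega>\<bar>) T \<omega> powr p"
proof -
  have absX: "continuous_process (\<lambda>t \<omega>. \<bar>X t \<omega>\<bar>)" by (intro continuous_process_compose[OF X] continuous_intros)
  have T: "T \<in> {0..T}" using T_nonneg by simp
  obtain s where s: "s \<in> {0..T}" "running_sup (\<lambda>t \<omega>. \<bar>X t \<omega>\<bar>) T \<omega> = \<bar>X s \<omega>\<bar>"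
      "\<And>u. u \<in> {0..T} \<Longrightarrow> \<bar>X u \<omega>\<bar> \<le> \<bar>X s \<omega>\<bar>"
    using running_sup_attained[OF absX \<omega> T] by metis
  show ?thesis unfolding s(2)
  proof (rule cSup_eq_maximum)
    show "\<bar>X s \<omega>\<bar> powr p \<in> (\<lambda>t. \<bar>Y t \<omega>\<bar> powr p) ` {0..T}" using s(1) eq by auto
    show "y \<le> \<bar>X s \<omega>\<bar> powr p" if "y \<in> (\<lambda>t. \<bar>Y t \<omega>\<bar> powr p) ` {0..T}" for y
      using that eq s(3) p by (auto intro!: powr_mono2)
  qed
qed

end

theorem corollary2p1:
  fixes P :: "'a measure" and T p :: real
    and B :: "real \<Rightarrow> 'a \<Rightarrow> real ^ 'd" and F :: "real \<Rightarrow> 'a measure"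
    and M QV :: "nat \<Rightarrow> real \<Rightarrow> 'a \<Rightarrow> real"
  assumes "prob_space P" and "T > 0"
    and "brownian_motion P T B"
    and "F = augmented_natural_filtration P T B"
    and "sets P = sets (F T)"
    and "p > 0"
    and "\<And>n. continuous_local_martingale P F T (M n)"
    and "\<And>n. AE \<omega> in P. M n 0 \<omega> = 0"
    and "\<And>n. is_quadratic_variation P F T (M n) (QV n)"
  shows "(AE \<omega> in P. summable (\<lambda>n. QV n T \<omega> powr (p / 2))) \<longleftrightarrow>
         (AE \<omega> in P. summable (\<lambda>n. SUP t\<in>{0..T}. \<bar>M n t \<omega>\<bar> powr p))"
proof -
  interpret complete_filtered_space P F T
  proof (intro complete_filtered_space.intro complete_filtered_space_axioms.intro)
    show "filtration (space P) F"
      unfolding assms(4) by (rule filtration_augmented_natural_filtration)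
    have sub: "{B s -` A \<inter> space P | s A. s \<in> {0..min t T} \<and> A \<in> sets borel} \<union>
        {N. \<exists>N'\<in>null_sets P. N \<subseteq> N'} \<subseteq> Pow (space P)" for t
      using sets.sets_into_space[of _ P] by (fastforce simp: null_sets_def)
    show "N \<in> sets (F t)" if "N \<in> null_sets P" for N t
      unfolding assms(4) augmented_natural_filtration_def sets_measure_of[OF sub]
      using that by (intro sigma_sets.Basic) auto
    show "0 \<le> T" using \<open>T > 0\<close> by simp
  qed (fact assms(1) assms(5)[symmetric])+
  \<comment> \<open>The two versions are packed into a pair so that one application of choice yields
    both sequences.\<close>
  have "\<exists>X. qv_pair (fst X) (snd X) \<and>
      (AE \<omega> in P. \<forall>t\<in>{0..T}. M n t \<omega> = fst X t \<omega> \<and> QV n t \<omega> = snd X t \<omega>)" for n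
    by (rule qv_pair_version[OF assms(7)[of n] assms(8)[of n] assms(9)[of n]])
       (rule exI[of _ "(M', A')" for M' A'], simp)
  then have "\<forall>n. \<exists>X. qv_pair (fst X) (snd X) \<and>
      (AE \<omega> in P. \<forall>t\<in>{0..T}. M n t \<omega> = fst X t \<omega> \<and> QV n t \<omega> = snd X t \<omega>)" ..
  from choice[OF this] obtain X where X: "\<And>n. qv_pair (fst (X n)) (snd (X n)) \<and>
      (AE \<omega> in P. \<forall>t\<in>{0..T}. M n t \<omega> = fst (X n) t \<omega> \<and> QV n t \<omega> = snd (X n) t \<omega>)"
    by blast
  define M' where "M' = (\<lambda>n. fst (X n))"
  define A' where "A' = (\<lambda>n. snd (X n))"
  have MA: "qv_pair (M' n) (A' n)"
    and eq: "AE \<omega> in P. \<forall>t\<in>{0..T}. M n t \<omega> = M' n t \<omega> \<and> QV n t \<omega> = A' n t \<omega>" for n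
    using X[of n] unfolding M'_def A'_def by blast+
  have T: "T \<in> {0..T}" using \<open>T > 0\<close> by simp
  \<comment> \<open>There are countably many indices, so one null set serves for all of them and
    whole series can be compared path by path.\<close>
  have all: "AE \<omega> in P. \<forall>n. \<forall>t\<in>{0..T}. M n t \<omega> = M' n t \<omega> \<and> QV n t \<omega> = A' n t \<omega>"
    using eq by (simp add: AE_all_countable)
  have QV: "AE \<omega> in P. summable (\<lambda>n. QV n T \<omega> powr (p / 2)) = summable (\<lambda>n. A' n T \<omega> powr (p / 2))"
    using all by eventually_elim (use T in auto)
  have SUP: "AE \<omega> in P. summable (\<lambda>n. SUP t\<in>{0..T}. \<bar>M n t \<omega>\<bar> powr p) =
      summable (\<lambda>n. running_sup (\<lambda>t \<omega>. \<bar>M' n t \<omega>\<bar>) T \<omega> powr p)"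
    using all AE_space
  proof eventually_elim
    case (elim \<omega>)
    have "(SUP t\<in>{0..T}. \<bar>M n t \<omega>\<bar> powr p) = running_sup (\<lambda>t \<omega>. \<bar>M' n t \<omega>\<bar>) T \<omega> powr p" for n
      using elim MA[of n] by (intro SUP_powr_eq_running_sup \<open>p > 0\<close>) (auto simp: qv_pair_def)
    then show ?case by simp
  qed
  have "(AE \<omega> in P. summable (\<lambda>n. QV n T \<omega> powr (p / 2))) \<longleftrightarrow>
      (AE \<omega> in P. summable (\<lambda>n. A' n T \<omega> powr (p / 2)))"
    using QV by (rule eventually_subst)
  moreover have "(AE \<omega> in P. summable (\<lambda>n. SUP t\<in>{0..T}. \<bar>M n t \<omega>\<bar> powr p)) \<longleftrightarrow>
      (AE \<omega> in P. summable (\<lambda>n. running_sup (\<lambda>t \<omega>. \<bar>M' n t \<omega>\<bar>) T \<omega> powr p))"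
    using SUP by (rule eventually_subst)
  ultimately show ?thesis using qv_pair_summable_iff[OF MA \<open>p > 0\<close>] by simp
qed

end
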